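(* Let $\mathbf{M}$ be a Markov process with state space $(S,\mathcal{S})$ and transition function $p^{t}(x,dy)$, $t\in\mathbb{T}$, $x\in S$. Assume that there is $\pi\in\mathcal{P}(S)$ satisfying $$\lim_{t\to\infty}\ \sup_{s\in\mathbb{T}}\int_S d_W\big(p^{t}(y,dz),\pi(dz)\big)\,p^{s}(x,dy)=0\qquad\text{for every } x\in S.$$ Assume in addition that $\pi$ is an invariant measure for $\mathbf{M}$ and that $(S,d)$ is also a locally compact space. Then, for every $p\ge1$ and every $f\in L^p(S,\pi)$, $$\frac{1}{t}\int_{[0,t)}f(M_s)\,\tau(ds)\longrightarrow \int_S f(y)\,\pi(dy)\qquad\text{in } L^p(\Omega,\mathbb{P}^{\pi})\ \text{ as } t\nearrow\infty,\ t\in\mathbb{T}.$$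
   Context: State space: $(S,d)$ is a non-empty Polish space, i.e. $d$ is a complete and separable metric on $S$, $\mathcal{S}$ is its Borel $\sigma$-algebra, and $d$ is bounded by $1$: $\sup_{x,y\in S}d(x,y)\le 1$. The time set $\mathbb{T}$ is either $\{0,1,2,\ldots\}$ or $[0,\infty)$, and $\tau$ is the counting measure on $\mathbb{T}$ in the first case and Lebesgue measure in the second. Process: $\mathbf{M}=(\Omega,\mathcal{F},\{\mathbb{P}^{x}\}_{x\in S},\{\mathcal{F}_t\}_{t\in\mathbb{T}},\{\theta_t\}_{t\in\mathbb{T}},\{M_t\}_{t\in\mathbb{T}})$ is a temporally homogeneous normal Markov process with state space $(S,\mathcal{S})$: each $(\Omega,\mathcal{F},\mathbb{P}^x)$ is a probability space; $\{\mathcal{F}_t\}$ is a filtration; $M_t:\Omega\to S$ is $\mathcal{F}_t/\mathcal{S}$-measurable; $\mathbb{P}^x(M_0=x)=1$ (normality); $x\mapsto\mathbb{P}^x(B)$ is $\mathcal{S}$-measurable for $B\in\mathcal{F}$; the shift operators $\theta_t:\Omega\to\Omega$ satisfy $M_t\circ\theta_s=M_{t+s}$; and the Markov property $\mathbb{P}^x(M_{t+s}\in B\mid\mathcal{F}_t)=p^s(M_t,B)$ $\mathbb{P}^x$-a.s. holds for all $s,t\in\mathbb{T}$, $x\in S$, $B\in\mathcal{S}$, where $p^{t}(x,dy):=\mathbb{P}^{x}(M_t\in dy)$ is the transition function. If $\mathbb{T}=[0,\infty)$, $\mathbf{M}$ is assumed progressively measurable: for each $t\ge0$ the map $(s,\omega)\mapsto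 M_s(\omega)$ from $[0,t]\times\Omega$ to $S$ is $\mathcal{B}([0,t])\times\mathcal{F}_t/\mathcal{S}$-measurable. $\mathcal{P}(S)$ is the set of probability measures on $\mathcal{S}$; for $\mu\in\mathcal{P}(S)$, $\mathbb{P}^\mu(d\omega):=\int_S\mathbb{P}^y(d\omega)\,\mu(dy)$. A measure $\pi$ on $\mathcal{S}$ is invariant for $\mathbf{M}$ if $\int_S p^t(x,dy)\,\pi(dx)=\pi(dy)$ for all $t\in\mathbb{T}$. $L^p(S,\pi)$ is the space of measurable $f:S\to\mathbb{R}$ with $\int_S|f|^p\,d\pi<\infty$, and similarly for $L^p(\Omega,\mathbb{P}^\pi)$. $Lip(S)$ is the space of all $f:S\to\mathbb{R}$ for which there is $L_f\ge0$ with $|f(x)-f(y)|\le L_f\,d(x,y)$ for all $x,y\in S$; the best constant is denoted $|f|_{Lip}$. The $L^1$-Wasserstein metric on $\mathcal{P}(S)$ is $$d_W(\mu,\nu):=\sup_{f\in Lip(S),\,|f|_{Lip}\le1}\left|\int_S f\,d\mu-\int_S f\,d\nu\right|.$$ The function $x\mapsto d_W(p^t(x,dy),\pi(dy))$ is $\mathcal{S}$-measurable for each $t\in\mathbb{T}$. *)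

theory Defs
  imports "HOL-Probability.Probability"
begin

text \<open>
  The Polish state space is a type \<open>'a :: polish_space\<close> with its metric \<open>dist\<close>; that \<open>dist\<close> is
  bounded by 1 is an explicit hypothesis of the theorem.  Both kinds of time set are subsets of
  \<open>real\<close>, so that one set of definitions covers discrete and continuous time.
\<close>

definition time_set :: "real set \<Rightarrow> bool" where
  "time_set T \<longleftrightarrow> T = \<nat> \<or> T = {0..}"

definition time_measure :: "real set \<Rightarrow> real measure" where
  "time_measure T = (if T = \<nat> then count_space \<nat> else restrict_space lborel T)"

definition time_at_top :: "real set \<Rightarrow> real filter" where
  "time_at_top T = inf at_top (principal T)"

definition transition ::
    "('a :: topological_space \<Rightarrow> 'w measure) \<Rightarrow> (real \<Rightarrow> 'w \<Rightarrow> 'a) \<Rightarrow> real \<Rightarrow> 'a \<Rightarrow> 'a measure" where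
  "transition P M t x = distr (P x) borel (M t)"

text \<open>
  \<open>F\<close> and \<open>Ft t\<close> are used only as measurable spaces (underlying set and \<open>\<sigma>\<close>-algebra).
  Only the values of \<open>Ft\<close>, \<open>\<theta>\<close> and \<open>M\<close> at times in \<open>T\<close> matter.  The shifts are not required to be
  measurable.
\<close>

locale markov_process =
  fixes T :: "real set"
    and F :: "'w measure"
    and P :: "'a :: polish_space \<Rightarrow> 'w measure"
    and Ft :: "real \<Rightarrow> 'w measure"
    and \<theta> :: "real \<Rightarrow> 'w \<Rightarrow> 'w"
    and M :: "real \<Rightarrow> 'w \<Rightarrow> 'a"
  assumes time_set: "time_set T"
    and prob_space_P: "\<And>x. prob_space (P x)"
    and sets_P: "\<And>x. sets (P x) = sets F"
    and subalgebra_Ft: "\<And>t. t \<in> T \<Longrightarrow> subalgebra F (Ft t)"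
    and Ft_mono: "\<And>s t. s \<in> T \<Longrightarrow> t \<in> T \<Longrightarrow> s \<le> t \<Longrightarrow> subalgebra (Ft t) (Ft s)"
    and adapted: "\<And>t. t \<in> T \<Longrightarrow> M t \<in> Ft t \<rightarrow>\<^sub>M borel"
    and normal: "\<And>x. measure (P x) {\<omega> \<in> space F. M 0 \<omega> = x} = 1"
    and measurable_P: "\<And>B. B \<in> sets F \<Longrightarrow> (\<lambda>x. measure (P x) B) \<in> borel_measurable borel"
    and shift_space: "\<And>t \<omega>. t \<in> T \<Longrightarrow> \<omega> \<in> space F \<Longrightarrow> \<theta> t \<omega> \<in> space F"
    and shift: "\<And>s t \<omega>. s \<in> T \<Longrightarrow> t \<in> T \<Longrightarrow> \<omega> \<in> space F \<Longrightarrow> M t (\<theta> s \<omega>) = M (t + s) \<omega>"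
    and markov: "\<And>s t x B. s \<in> T \<Longrightarrow> t \<in> T \<Longrightarrow> B \<in> sets borel \<Longrightarrow>
      AE \<omega> in P x. real_cond_exp (P x) (Ft t) (indicator {\<omega> \<in> space F. M (t + s) \<omega> \<in> B}) \<omega>
        = measure (transition P M s (M t \<omega>)) B"
    and progressive: "\<And>t. T = {0..} \<Longrightarrow> 0 \<le> t \<Longrightarrow>
      (\<lambda>(s, \<omega>). M s \<omega>) \<in> restrict_space borel {0..t} \<Otimes>\<^sub>M Ft t \<rightarrow>\<^sub>M borel"

definition invariant_measure ::
    "real set \<Rightarrow> ('a :: topological_space \<Rightarrow> 'w measure) \<Rightarrow> (real \<Rightarrow> 'w \<Rightarrow> 'a) \<Rightarrow> 'a measure \<Rightarrow> bool" where
  "invariant_measure T P M \<pi> \<longleftrightarrow> sets \<pi> = sets borel \<and>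
     (\<forall>t\<in>T. \<forall>B\<in>sets borel. (\<integral>\<^sup>+ x. emeasure (transition P M t x) B \<partial>\<pi>) = emeasure \<pi> B)"

definition Lip :: "('a :: metric_space \<Rightarrow> real) set" where
  "Lip = {f. \<exists>L. L-lipschitz_on UNIV f}"

definition lip_seminorm :: "('a :: metric_space \<Rightarrow> real) \<Rightarrow> real" where
  "lip_seminorm f = Inf {L. L-lipschitz_on UNIV f}"

text \<open>
  For probability measures on a space of diameter at most 1 the set below is bounded by 1, so the
  real-valued supremum is the true one.
\<close>

definition wasserstein :: "('a :: metric_space) measure \<Rightarrow> 'a measure \<Rightarrow> real" where
  "wasserstein \<mu> \<nu> = (SUP f \<in> {f \<in> Lip. lip_seminorm f \<le> 1}. \<bar>(\<integral>x. f x \<partial>\<mu>) - (\<integral>x. f x \<partial>\<nu>)\<bar>)"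

definition Lp :: "real \<Rightarrow> 'b measure \<Rightarrow> ('b \<Rightarrow> real) set" where
  "Lp p N = {f \<in> borel_measurable N. integrable N (\<lambda>x. \<bar>f x\<bar> powr p)}"

definition Lp_norm :: "real \<Rightarrow> 'b measure \<Rightarrow> ('b \<Rightarrow> real) \<Rightarrow> real" where
  "Lp_norm p N f = (\<integral>x. \<bar>f x\<bar> powr p \<partial>N) powr (1 / p)"

text \<open>
  Membership in \<open>Lp\<close> is required explicitly, because the Bochner integral of a non-integrable
  function is 0 by convention.
\<close>

definition tendsto_Lp ::
    "real \<Rightarrow> 'b measure \<Rightarrow> ('i \<Rightarrow> 'b \<Rightarrow> real) \<Rightarrow> ('b \<Rightarrow> real) \<Rightarrow> 'i filter \<Rightarrow> bool" where
  "tendsto_Lp p N X Y G \<longleftrightarrow>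
     (\<forall>\<^sub>F t in G. X t \<in> Lp p N) \<and> Y \<in> Lp p N \<and>
     ((\<lambda>t. Lp_norm p N (\<lambda>\<omega>. X t \<omega> - Y \<omega>)) \<longlongrightarrow> 0) G"

end

theory Submission
  imports Defs
begin

text \<open>
  Taking \<open>s = 0\<close> in the hypothesis gives \<open>d\<^sub>W(p\<^sup>t(x, \<cdot>), \<pi>) \<longrightarrow> 0\<close> for every \<open>x\<close>, provided that the
  integrand is measurable (otherwise its Bochner integral would be 0); measurability holds because
  the Wasserstein supremum may be taken over countably many functions.  Hence \<open>p\<^sup>t g \<longrightarrow> \<integral>g d\<pi>\<close>
  pointwise for bounded Lipschitz \<open>g\<close>, and by dominated convergence the stationary correlations
  of \<open>g(M\<^sub>s) - \<integral>g d\<pi>\<close> and \<open>g(M\<^sub>r) - \<integral>g d\<pi>\<close> tend to 0 as \<open>\<bar>s - r\<bar>\<close> grows.  Expanding the square and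
  using Fubini, the time averages of \<open>g\<close> converge in \<open>L\<^sup>2\<close>, and in \<open>L\<^sup>p\<close> since they are bounded.  By Jensen
  and stationarity the averaging map is an \<open>L\<^sup>p\<close>-contraction uniformly in \<open>t\<close>, and bounded Lipschitz
  functions are dense in \<open>L\<^sup>p(\<pi>)\<close>.  Both time sets are treated at once through the uniform
  distribution on \<open>[0, t) \<inter> T\<close>.
\<close>

section \<open>Bounded Lipschitz functions are dense in \<open>L\<^sup>p\<close>\<close>

text \<open>The hypothesis gives convergence of \<open>p^t g\<close> for each starting point
  separately, without a rate uniform in the point. This suffices because, under the stationary law,
  the correlation at times \<open>s\<close> and \<open>r\<close> depends only on the lag
  \<open>\<bar>s - r\<bar>\<close>: a single dominated convergence under \<open>\<pi>\<close> bounds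
  all pairs with large lag at once. For fixed \<open>s\<close>, the exceptional times
  \<open>r\<close> lie in a window whose mass is bounded independently of \<open>s\<close> and
  \<open>t\<close>, so its share of \<open>[0, t)\<close> vanishes. Errors in \<open>L^p\<close> are
  added by means of \<open>\<bar>a + b\<bar> powr p \<le> 2 powr p * (\<bar>a\<bar> powr p +
  \<bar>b\<bar> powr p)\<close> instead of Minkowski's inequality. All estimates then concern
  integrals of p-th powers, the root is taken only at the very end, and the constants
  \<open>2 powr p\<close> below come from here.\<close>

lemma abs_add_powr_le:
  fixes a b p :: real
  assumes "0 \<le> p"
  shows "\<bar>a + b\<bar> powr p \<le> 2 powr p * (\<bar>a\<bar> powr p + \<bar>b\<bar> powr p)"
proof -
  define m where "m = max \<bar>a\<bar> \<bar>b\<bar>"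
  have "\<bar>a + b\<bar> powr p \<le> (2 * m) powr p"
    using assms by (intro powr_mono2) (auto simp: m_def)
  also have "\<dots> = 2 powr p * m powr p"
    by (simp add: powr_mult m_def)
  also have "\<dots> \<le> 2 powr p * (\<bar>a\<bar> powr p + \<bar>b\<bar> powr p)"
    by (intro mult_left_mono) (auto simp: m_def max_def)
  finally show ?thesis .
qed

text \<open>Convexity on nonnegative arguments passes to \<open>\<bar>x\<bar>\<close>, because
  powers are monotone there and the absolute value is convex. When one argument vanishes, what
  remains is \<open>c powr p \<le> c\<close> for \<open>0 < c < 1\<close>, which is the content of
  \<open>scale\<close>.\<close>

lemma convex_on_abs_powr:
  fixes p :: real
  assumes p: "1 \<le> p"
  shows "convex_on UNIV (\<lambda>x. \<bar>x\<bar> powr p)"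
proof (rule convex_onI)
  fix t x y :: real
  assume t: "0 < t" "t < 1"
  have scale: "(c * z) powr p \<le> c * z powr p" if "0 < c" "c < 1" "0 \<le> z" for c z :: real
  proof -
    have "c powr p \<le> c powr 1"
      using that p by (intro powr_mono') auto
    with that show ?thesis
      by (auto simp: powr_mult intro!: mult_right_mono)
  qed
  have "((1 - t) * a + t * b) powr p \<le> (1 - t) * a powr p + t * b powr p"
    if "0 \<le> a" "0 \<le> b" for a b :: real
  proof (cases "a = 0 \<or> b = 0")
    case True
    with scale[of t b] scale[of "1 - t" a] that t p show ?thesis by auto
  next
    case False
    with that t convex_onD[OF powr_convex[OF p], of t a b] show ?thesis
      by simp
  qed
  note this[of "\<bar>x\<bar>" "\<bar>y\<bar>"]
  moreover have "\<bar>(1 - t) *\<^sub>R x + t *\<^sub>R y\<bar> powr p \<le> ((1 - t) * \<bar>x\<bar> + t * \<bar>y\<bar>) powr p"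
    using t p by (intro powr_mono2 order_trans[OF abs_triangle_ineq]) (auto simp: abs_mult)
  ultimately show "\<bar>(1 - t) *\<^sub>R x + t *\<^sub>R y\<bar> powr p \<le> (1 - t) * \<bar>x\<bar> powr p + t * \<bar>y\<bar> powr p"
    by simp
qed simp

lemma le_one_add_powr:
  fixes a p :: real
  assumes "1 \<le> p"
  shows "\<bar>a\<bar> \<le> 1 + \<bar>a\<bar> powr p"
proof (cases "\<bar>a\<bar> \<le> 1")
  case False
  with powr_mono[OF assms, of "\<bar>a\<bar>"] show ?thesis by simp
qed (simp add: add_increasing2)

lemma (in finite_measure) integrable_of_integrable_powr:
  fixes f :: "'a \<Rightarrow> real"
  assumes "1 \<le> p" "f \<in> borel_measurable M" "integrable M (\<lambda>x. \<bar>f x\<bar> powr p)"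
  shows "integrable M f"
  by (rule Bochner_Integration.integrable_bound[OF Bochner_Integration.integrable_add[OF integrable_const[of 1] assms(3)] assms(2)])
    (auto intro!: AE_I2 simp: le_one_add_powr[OF assms(1)])

lemma (in prob_space) abs_expectation_powr_le:
  fixes f :: "'a \<Rightarrow> real"
  assumes "1 \<le> p" "f \<in> borel_measurable M" "integrable M (\<lambda>x. \<bar>f x\<bar> powr p)"
  shows "\<bar>expectation f\<bar> powr p \<le> expectation (\<lambda>x. \<bar>f x\<bar> powr p)"
  using jensens_inequality[of f UNIV 0 0 "\<lambda>x. \<bar>x\<bar> powr p"]
    integrable_of_integrable_powr[OF assms] assms(3) convex_on_abs_powr[OF assms(1)] by simp

lemma (in finite_measure) integrable_bounded:
  fixes f :: "'a \<Rightarrow> real"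
  assumes "f \<in> borel_measurable M" "\<And>x. x \<in> space M \<Longrightarrow> \<bar>f x\<bar> \<le> K"
  shows "integrable M f"
  using assms by (intro integrable_const_bound[of _ K]) auto

section \<open>Lipschitz functions, clamping and cut-offs\<close>

lemma lipschitz_on_borel_measurable:
  fixes g :: "'a::metric_space \<Rightarrow> real"
  assumes "L-lipschitz_on UNIV g"
  shows "g \<in> borel_measurable borel"
  using lipschitz_on_continuous_on[OF assms] by (rule borel_measurable_continuous_onI)

lemma lipschitz_on_max_real:
  fixes f g :: "'a::metric_space \<Rightarrow> real"
  assumes "L-lipschitz_on U f" "L-lipschitz_on U g"
  shows "L-lipschitz_on U (\<lambda>x. max (f x) (g x))"
proof (rule lipschitz_onI)
  fix x y assume "x \<in> U" "y \<in> U"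
  with lipschitz_onD[OF assms(1), of x y] lipschitz_onD[OF assms(2), of x y]
  show "dist (max (f x) (g x)) (max (f y) (g y)) \<le> L * dist x y"
    by (auto simp: dist_real_def max_def)
qed (rule lipschitz_on_nonneg[OF assms(1)])

lemma lipschitz_on_clamp:
  fixes g :: "'a::metric_space \<Rightarrow> real"
  assumes "L-lipschitz_on U g"
  shows "L-lipschitz_on U (\<lambda>x. max (- c) (min c (g x)))"
proof (rule lipschitz_onI)
  fix x y assume "x \<in> U" "y \<in> U"
  with lipschitz_onD[OF assms(1), of x y]
  show "dist (max (- c) (min c (g x))) (max (- c) (min c (g y))) \<le> L * dist x y"
    by (auto simp: dist_real_def max_def min_def)
qed (rule lipschitz_on_nonneg[OF assms(1)])

lemma lipschitz_on_infdist: "1-lipschitz_on U (\<lambda>x. infdist x A)"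
  by (rule lipschitz_onI) (auto simp: dist_real_def infdist_triangle_abs)

text \<open>The Lipschitz clause gives access to the Wasserstein distance; the uniform bound gives
  integrability, dominated convergence and the passage from \<open>L^2\<close> to
  \<open>L^p\<close>. Density is proved without a bound on the diameter of the space, so boundedness
  is a clause of its own.\<close>

definition bounded_lipschitz :: "('a::metric_space \<Rightarrow> real) \<Rightarrow> bool" where
  "bounded_lipschitz g \<longleftrightarrow> (\<exists>L. L-lipschitz_on UNIV g) \<and> (\<exists>K. \<forall>x. \<bar>g x\<bar> \<le> K)"

lemma bounded_lipschitz_measurable:
  "bounded_lipschitz g \<Longrightarrow> g \<in> borel_measurable borel"
  by (auto simp: bounded_lipschitz_def lipschitz_on_borel_measurable)

lemma bounded_lipschitz_add:
  assumes "bounded_lipschitz f" "bounded_lipschitz g"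
  shows "bounded_lipschitz (\<lambda>x. f x + g x)"
proof -
  from assms obtain L K L' K' where
    "L-lipschitz_on UNIV f" "\<And>x. \<bar>f x\<bar> \<le> K" "L'-lipschitz_on UNIV g" "\<And>x. \<bar>g x\<bar> \<le> K'"
    by (auto simp: bounded_lipschitz_def)
  then show ?thesis
    unfolding bounded_lipschitz_def
    by (intro conjI exI[of _ "L + L'"] exI[of _ "K + K'"] allI lipschitz_on_add
        order_trans[OF abs_triangle_ineq] add_mono)
qed

lemma bounded_lipschitz_cmult:
  assumes "bounded_lipschitz f"
  shows "bounded_lipschitz (\<lambda>x. c * f x)"
proof -
  from assms obtain L K where "L-lipschitz_on UNIV f" "\<And>x. \<bar>f x\<bar> \<le> K"
    by (auto simp: bounded_lipschitz_def)
  then show ?thesis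
    unfolding bounded_lipschitz_def
    by (intro conjI exI[of _ "\<bar>c\<bar> * L"] exI[of _ "\<bar>c\<bar> * K"] allI lipschitz_on_cmult_real)
      (auto simp: abs_mult intro!: mult_left_mono)
qed

lemma bounded_lipschitz_const: "bounded_lipschitz (\<lambda>x. c)"
  unfolding bounded_lipschitz_def by (auto intro: lipschitz_on_constant)

lemma bounded_lipschitz_clamp:
  assumes "bounded_lipschitz g" "0 \<le> c"
  shows "bounded_lipschitz (\<lambda>x. max (- c) (min c (g x)))"
proof -
  from assms obtain L where "L-lipschitz_on UNIV g" by (auto simp: bounded_lipschitz_def)
  then have "L-lipschitz_on UNIV (\<lambda>x. max (- c) (min c (g x)))" by (rule lipschitz_on_clamp)
  moreover have "\<bar>max (- c) (min c (g x))\<bar> \<le> c" for x using assms(2) by auto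
  ultimately show ?thesis unfolding bounded_lipschitz_def by blast
qed

text \<open>The cut-offs \<open>max 0 (1 - n * infdist x C)\<close> equal 1 on \<open>C\<close>. Off
  a closed set the distance is positive, so they vanish as soon as \<open>n\<close> exceeds its
  reciprocal.\<close>

lemma closed_indicator_limit:
  fixes C :: "'a::metric_space set"
  assumes "closed C"
  obtains h where "\<And>n::nat. bounded_lipschitz (h n)" "\<And>n x. \<bar>h n x\<bar> \<le> 1"
    "\<And>x. (\<lambda>n. h n x) \<longlonglongrightarrow> indicator C x"
\<comment> \<open>By convention \<open>infdist x {} = 0\<close>, so the cut-offs of the empty set
  would be constantly 1.\<close>
proof (cases "C = {}")
  case True
  then show ?thesis
    by (intro that[of "\<lambda>_ _. 0"]) (auto simp: bounded_lipschitz_const)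
next
  case False
  define h where "h n x = max 0 (1 - real n * infdist x C)" for n x
  have b: "\<bar>h n x\<bar> \<le> 1" for n x
    by (auto simp: h_def infdist_nonneg)
  have "(real n)-lipschitz_on UNIV (\<lambda>x. 1 - real n * infdist x C)" for n
    using lipschitz_on_diff[OF lipschitz_on_constant[of UNIV 1]
        lipschitz_on_cmult_real_nonneg[OF lipschitz_on_infdist[of UNIV C], of "real n"]] by simp
  then have "(real n)-lipschitz_on UNIV (h n)" for n
    unfolding h_def by (intro lipschitz_on_max_real lipschitz_on_mono[OF lipschitz_on_constant]) auto
  with b have l: "bounded_lipschitz (h n)" for n
    unfolding bounded_lipschitz_def by blast
  have "(\<lambda>n. h n x) \<longlonglongrightarrow> indicator C x" for x
  proof (cases "x \<in> C")
    case True
    then show ?thesis by (simp add: h_def)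
  next
    case x: False
    then have d: "0 < infdist x C"
      using infdist_pos_not_in_closed[OF assms False] by simp
    obtain N :: nat where N: "1 < real N * infdist x C"
      using reals_Archimedean3[OF d] by metis
    have "h n x = 0" if "N \<le> n" for n
    proof -
      have "real N * infdist x C \<le> real n * infdist x C"
        using that d by (intro mult_right_mono) auto
      with N show ?thesis by (simp add: h_def)
    qed
    then have "eventually (\<lambda>n. h n x = 0) sequentially"
      by (auto simp: eventually_sequentially)
    with x show ?thesis by (simp add: tendsto_eventually)
  qed
  with b l that show ?thesis by blast
qed

text \<open>The functions approximable in \<open>L^1\<close> (the predicate \<open>Q\<close>) are
  closed under \<open>L^1\<close> limits, sums and scaling, so induction over integrable functions
  reduces the claim to indicators. Those of closed sets are dominated limits of cut-offs. Those of
  Borel sets are reached from inside, since a finite Borel measure on a Polish space is inner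
  regular with respect to compact sets.\<close>

lemma L1_bounded_lipschitz_approx:
  fixes f :: "'a::polish_space \<Rightarrow> real"
  assumes \<pi>: "sets \<pi> = sets borel" "finite_measure \<pi>" and f: "integrable \<pi> f" and "0 < e"
  obtains g where "bounded_lipschitz g" "(\<integral>x. \<bar>f x - g x\<bar> \<partial>\<pi>) < e"
proof -
  interpret finite_measure \<pi> by fact
  note [measurable_cong] = \<pi>(1)
  have int_bl: "integrable \<pi> g" if "bounded_lipschitz g" for g
  proof -
    note [measurable] = bounded_lipschitz_measurable[OF that]
    from that obtain K where "\<And>x. \<bar>g x\<bar> \<le> K" by (auto simp: bounded_lipschitz_def)
    then show ?thesis by (intro integrable_bounded) auto
  qed
  have tri: "(\<integral>x. \<bar>u x - w x\<bar> \<partial>\<pi>) \<le> (\<integral>x. \<bar>u x - v x\<bar> \<partial>\<pi>) + (\<integral>x. \<bar>v x - w x\<bar> \<partial>\<pi>)"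
    if "integrable \<pi> u" "integrable \<pi> v" "integrable \<pi> w" for u v w :: "'a \<Rightarrow> real"
  proof -
    have "(\<integral>x. \<bar>u x - w x\<bar> \<partial>\<pi>) \<le> (\<integral>x. \<bar>u x - v x\<bar> + \<bar>v x - w x\<bar> \<partial>\<pi>)"
      using that by (intro integral_mono) auto
    with that show ?thesis by simp
  qed
  define Q where "Q u \<longleftrightarrow> (\<forall>e>0. \<exists>g. bounded_lipschitz g \<and> (\<integral>x. \<bar>u x - g x\<bar> \<partial>\<pi>) < e)"
    for u :: "'a \<Rightarrow> real"
  have Q_lim: "Q u" if u: "integrable \<pi> u" and s: "\<And>n. integrable \<pi> (s n)" "\<And>n. Q (s n)"
    and lim: "(\<lambda>n. \<integral>x. \<bar>u x - s n x\<bar> \<partial>\<pi>) \<longlonglongrightarrow> 0" for u s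
    unfolding Q_def
  proof safe
    fix e :: real assume "0 < e"
    then have "eventually (\<lambda>n. (\<integral>x. \<bar>u x - s n x\<bar> \<partial>\<pi>) < e / 2) sequentially"
      using lim by (intro order_tendstoD(2)) auto
    then obtain n where n: "(\<integral>x. \<bar>u x - s n x\<bar> \<partial>\<pi>) < e / 2"
      by (auto simp: eventually_sequentially)
    from s(2)[of n] \<open>0 < e\<close> obtain g where g: "bounded_lipschitz g" "(\<integral>x. \<bar>s n x - g x\<bar> \<partial>\<pi>) < e / 2"
      unfolding Q_def by (meson half_gt_zero)
    with tri[OF u s(1) int_bl[OF g(1)], of n] n
    show "\<exists>g. bounded_lipschitz g \<and> (\<integral>x. \<bar>u x - g x\<bar> \<partial>\<pi>) < e" by force
  qed
  have Q_bl: "Q g" if "bounded_lipschitz g" for g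
    unfolding Q_def using that by (intro allI impI exI[of _ g]) auto
  have Q_cmult: "Q (\<lambda>x. c * u x)" if "Q u" for u c
    unfolding Q_def
  proof safe
    fix e :: real assume "0 < e"
    \<comment> \<open>Adding 1 keeps the denominator positive when \<open>c = 0\<close>.\<close>
    then have "0 < e / (\<bar>c\<bar> + 1)" by auto
    with that obtain g where g: "bounded_lipschitz g" "(\<integral>x. \<bar>u x - g x\<bar> \<partial>\<pi>) < e / (\<bar>c\<bar> + 1)"
      unfolding Q_def by blast
    have "(\<integral>x. \<bar>c * u x - c * g x\<bar> \<partial>\<pi>) = \<bar>c\<bar> * (\<integral>x. \<bar>u x - g x\<bar> \<partial>\<pi>)"
      by (simp add: abs_mult flip: right_diff_distrib)
    also have "\<dots> \<le> (\<bar>c\<bar> + 1) * (\<integral>x. \<bar>u x - g x\<bar> \<partial>\<pi>)"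
      by (intro mult_right_mono) auto
    also have "\<dots> < e"
      using g(2) by (simp add: pos_less_divide_eq mult.commute)
    finally show "\<exists>g. bounded_lipschitz g \<and> (\<integral>x. \<bar>c * u x - g x\<bar> \<partial>\<pi>) < e"
      using bounded_lipschitz_cmult[OF g(1), of c] by blast
  qed
  have Q_closed: "Q (indicator C)" if C: "closed C" for C
  proof -
    have [measurable]: "C \<in> sets borel" using C by auto
    from closed_indicator_limit[OF C] obtain h :: "nat \<Rightarrow> 'a \<Rightarrow> real" where h: "\<And>n. bounded_lipschitz (h n)"
      "\<And>n x. \<bar>h n x\<bar> \<le> 1" "\<And>x. (\<lambda>n. h n x) \<longlonglongrightarrow> indicator C x" by metis
    note [measurable] = bounded_lipschitz_measurable[OF h(1)]
    show ?thesis
    proof (rule Q_lim[of _ h])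
      show "(\<lambda>n. \<integral>x. \<bar>indicator C x - h n x\<bar> \<partial>\<pi>) \<longlonglongrightarrow> 0"
      proof -
        have "(\<lambda>n. \<integral>x. \<bar>indicator C x - h n x\<bar> \<partial>\<pi>) \<longlonglongrightarrow> (\<integral>x. 0 \<partial>\<pi>)"
        proof (rule integral_dominated_convergence[where w = "\<lambda>_. 2"])
          show "AE x in \<pi>. (\<lambda>n. \<bar>indicator C x - h n x\<bar>) \<longlonglongrightarrow> 0"
          proof (rule AE_I2)
            fix x
            show "(\<lambda>n. \<bar>indicator C x - h n x\<bar>) \<longlonglongrightarrow> 0"
              using tendsto_rabs[OF tendsto_diff[OF tendsto_const h(3)], of "indicator C x" x] by simp
          qed
          show "AE x in \<pi>. norm \<bar>indicator C x - h n x\<bar> \<le> 2" for n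
          proof (rule AE_I2)
            fix x
            show "norm \<bar>indicator C x - h n x\<bar> \<le> 2"
              using h(2)[of n x] by (auto simp: indicator_def)
          qed
        qed auto
        then show ?thesis by simp
      qed
    qed (auto intro!: int_bl Q_bl h simp: less_top[symmetric])
  qed
  have Q_ind: "Q (indicator A)" if A: "A \<in> sets \<pi>" for A
  proof -
    have "\<exists>C. C \<subseteq> A \<and> closed C \<and> measure \<pi> A < measure \<pi> C + 1 / Suc n" for n :: nat
    proof -
      have reg: "emeasure \<pi> A = (SUP K \<in> {K. K \<subseteq> A \<and> compact K}. emeasure \<pi> K)"
        using A \<pi> by (intro inner_regular) auto
      show ?thesis
      \<comment> \<open>\<open>ennreal\<close> sends negative numbers to 0, so the strict comparison
        with the supremum is faithful only if \<open>measure \<pi> A - 1 / Suc n\<close> is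
        nonnegative. Otherwise the empty set is already close enough.\<close>
      proof (cases "measure \<pi> A < 1 / Suc n")
        case True
        then show ?thesis by (intro exI[of _ "{}"]) auto
      next
        case False
        have "0 < 1 / real (Suc n)" by simp
        then have "ennreal (measure \<pi> A - 1 / Suc n) < emeasure \<pi> A"
          using False unfolding emeasure_eq_measure by (subst ennreal_less_iff) linarith+
        then obtain K where "K \<subseteq> A" "compact K" "ennreal (measure \<pi> A - 1 / Suc n) < emeasure \<pi> K"
          unfolding reg less_SUP_iff by auto
        then have "measure \<pi> A - 1 / Suc n < measure \<pi> K"
          using False unfolding emeasure_eq_measure by (subst (asm) ennreal_less_iff) auto
        with \<open>K \<subseteq> A\<close> \<open>compact K\<close> show ?thesis
          by (intro exI[of _ K]) (auto intro: compact_imp_closed)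
      qed
    qed
    then obtain C where C: "\<And>n. C n \<subseteq> A" "\<And>n. closed (C n)"
      "\<And>n::nat. measure \<pi> A < measure \<pi> (C n) + 1 / Suc n" by metis
    have Cs [measurable]: "C n \<in> sets \<pi>" for n using C(2)[of n] \<pi> by auto
    have eq: "(\<integral>x. \<bar>indicator A x - indicator (C n) x\<bar> \<partial>\<pi>) = measure \<pi> A - measure \<pi> (C n)" for n
    proof -
      have "(\<integral>x. \<bar>indicator A x - indicator (C n) x\<bar> \<partial>\<pi>) = (\<integral>x. (indicator (A - C n) x :: real) \<partial>\<pi>)"
        using C(1)[of n] by (intro Bochner_Integration.integral_cong) (auto split: split_indicator)
      then show ?thesis using C(1)[of n] A Cs[of n] by (simp add: finite_measure_Diff)
    qed
    show ?thesis
    proof (rule Q_lim[of _ "\<lambda>n. indicator (C n)"])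
      have "(\<lambda>n. measure \<pi> A - measure \<pi> (C n)) \<longlonglongrightarrow> 0"
      proof (rule tendsto_sandwich[OF _ _ tendsto_const LIMSEQ_Suc[OF lim_1_over_n]])
        show "\<forall>\<^sub>F n in sequentially. measure \<pi> A - measure \<pi> (C n) \<le> 1 / real (Suc n)"
          using C(3) by (intro always_eventually allI) (simp add: less_imp_le diff_le_eq add.commute)
        show "\<forall>\<^sub>F n in sequentially. 0 \<le> measure \<pi> A - measure \<pi> (C n)"
          using C(1) A by (intro always_eventually allI) (simp add: finite_measure_mono)
      qed
      then show "(\<lambda>n. \<integral>x. \<bar>indicator A x - indicat_real (C n) x\<bar> \<partial>\<pi>) \<longlonglongrightarrow> 0" by (simp add: eq)
      show "integrable \<pi> (indicat_real A)" "integrable \<pi> (indicat_real (C n))" for n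
        using A Cs[of n] by (simp_all add: less_top[symmetric])
    qed (rule Q_closed[OF C(2)])
  qed
  have "Q f" using f
  proof (induction rule: integrable_induct)
    case (base A c)
    then show ?case using Q_cmult[OF Q_ind, of A c] by (simp add: mult.commute)
  next
    case (add f g)
    show ?case unfolding Q_def
    proof safe
      fix e :: real assume "0 < e"
      with add obtain u v where u: "bounded_lipschitz u" "(\<integral>x. \<bar>f x - u x\<bar> \<partial>\<pi>) < e / 2"
        and v: "bounded_lipschitz v" "(\<integral>x. \<bar>g x - v x\<bar> \<partial>\<pi>) < e / 2"
        unfolding Q_def by (meson half_gt_zero)
      have "(\<integral>x. \<bar>f x + g x - (u x + v x)\<bar> \<partial>\<pi>) \<le> (\<integral>x. \<bar>f x - u x\<bar> \<partial>\<pi>) + (\<integral>x. \<bar>g x - v x\<bar> \<partial>\<pi>)"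
      proof -
        have "(\<integral>x. \<bar>f x + g x - (u x + v x)\<bar> \<partial>\<pi>) \<le> (\<integral>x. \<bar>f x - u x\<bar> + \<bar>g x - v x\<bar> \<partial>\<pi>)"
          using add.hyps int_bl[OF u(1)] int_bl[OF v(1)] by (intro integral_mono) auto
        with add.hyps int_bl[OF u(1)] int_bl[OF v(1)] show ?thesis by simp
      qed
      with u v show "\<exists>h. bounded_lipschitz h \<and> (\<integral>x. \<bar>f x + g x - h x\<bar> \<partial>\<pi>) < e"
        by (intro exI[of _ "\<lambda>x. u x + v x"]) (auto intro: bounded_lipschitz_add)
    qed
  next
    case (lim f s)
    note [measurable] = borel_measurable_integrable[OF lim.hyps(1)] borel_measurable_integrable[OF lim.hyps(4)]
    have "(\<lambda>n. \<integral>x. \<bar>f x - s n x\<bar> \<partial>\<pi>) \<longlonglongrightarrow> (\<integral>x. 0 \<partial>\<pi>)"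
    \<comment> \<open>The induction rule supplies approximants bounded by
      \<open>2 * \<bar>f x\<bar>\<close>; one more \<open>\<bar>f x\<bar>\<close> comes from
      \<open>f\<close> itself.\<close>
    proof (rule integral_dominated_convergence[where w = "\<lambda>x. 3 * \<bar>f x\<bar>"])
      show "AE x in \<pi>. (\<lambda>n. \<bar>f x - s n x\<bar>) \<longlonglongrightarrow> 0"
      proof (rule AE_I2)
        fix x assume "x \<in> space \<pi>"
        from tendsto_rabs[OF tendsto_diff[OF tendsto_const lim.hyps(2)[OF this]], of "f x"]
        show "(\<lambda>n. \<bar>f x - s n x\<bar>) \<longlonglongrightarrow> 0" by simp
      qed
      show "AE x in \<pi>. norm \<bar>f x - s n x\<bar> \<le> 3 * \<bar>f x\<bar>" for n
        using lim.hyps(3)[of _ n] by (intro AE_I2) force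
    qed (use lim.hyps(4) in auto)
    then show ?case by (intro Q_lim[OF lim.hyps(4,1) lim.IH]) simp
  qed
  with \<open>0 < e\<close> that show ?thesis unfolding Q_def by blast
qed

section \<open>The classes \<open>Lp\<close> and density for general exponents\<close>

lemma Lp_diff:
  assumes "0 \<le> p" "u \<in> Lp p N" "v \<in> Lp p N"
  shows "(\<lambda>x. u x - v x) \<in> Lp p N"
proof -
  have [measurable]: "u \<in> borel_measurable N" "v \<in> borel_measurable N"
    and i: "integrable N (\<lambda>x. \<bar>u x\<bar> powr p)" "integrable N (\<lambda>x. \<bar>v x\<bar> powr p)"
    using assms by (auto simp: Lp_def)
  have "integrable N (\<lambda>x. 2 powr p * (\<bar>u x\<bar> powr p + \<bar>v x\<bar> powr p))" using i by simp
  then have "integrable N (\<lambda>x. \<bar>u x - v x\<bar> powr p)"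
  proof (rule Bochner_Integration.integrable_bound)
    show "AE x in N. norm (\<bar>u x - v x\<bar> powr p) \<le> norm (2 powr p * (\<bar>u x\<bar> powr p + \<bar>v x\<bar> powr p))"
      using abs_add_powr_le[OF assms(1), of "u _" "- v _"] by (intro AE_I2) simp
  qed measurable
  then show ?thesis by (simp add: Lp_def)
qed

lemma (in finite_measure) Lp_const: "(\<lambda>_. c) \<in> Lp p M"
  by (simp add: Lp_def)

lemma (in finite_measure) Lp_imp_integrable: "1 \<le> p \<Longrightarrow> f \<in> Lp p M \<Longrightarrow> integrable M f"
  by (rule integrable_of_integrable_powr) (auto simp: Lp_def)

lemma Lp_cong:
  assumes "\<And>x. x \<in> space N \<Longrightarrow> u x = v x"
  shows "u \<in> Lp p N \<longleftrightarrow> v \<in> Lp p N"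
  using assms by (simp add: Lp_def cong: measurable_cong Bochner_Integration.integrable_cong)

lemma bounded_lipschitz_Lp:
  assumes \<pi>: "sets \<pi> = sets borel" "finite_measure \<pi>" and g: "bounded_lipschitz g" and "0 \<le> p"
  shows "g \<in> Lp p \<pi>"
proof -
  interpret finite_measure \<pi> by fact
  note [measurable_cong] = \<pi>(1)
  note [measurable] = bounded_lipschitz_measurable[OF g]
  obtain K where "\<And>x. \<bar>g x\<bar> \<le> K" using g by (auto simp: bounded_lipschitz_def)
  then have "integrable \<pi> (\<lambda>x. \<bar>g x\<bar> powr p)"
    using \<open>0 \<le> p\<close> by (intro integrable_bounded[of _ "K powr p"]) (auto intro!: powr_mono2)
  then show ?thesis by (simp add: Lp_def)
qed

text \<open>Truncating \<open>f\<close> at height \<open>n\<close> costs little in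
  \<open>L^p\<close>. The truncation is approximated in \<open>L^1\<close>, and the approximant is
  clamped to the same interval. Differences of values in \<open>[-n, n]\<close> satisfy
  \<open>\<bar>u\<bar> powr p \<le> (2 * n) powr (p - 1) * \<bar>u\<bar>\<close>, so for them
  smallness in \<open>L^1\<close> is smallness in \<open>L^p\<close>.\<close>

lemma Lp_bounded_lipschitz_approx:
  fixes f :: "'a::polish_space \<Rightarrow> real"
  assumes \<pi>: "sets \<pi> = sets borel" "finite_measure \<pi>" and p: "1 \<le> p"
    and f: "f \<in> Lp p \<pi>" and "0 < e"
  obtains g where "bounded_lipschitz g" "(\<integral>x. \<bar>f x - g x\<bar> powr p \<partial>\<pi>) < e"
proof -
  interpret finite_measure \<pi> by fact
  note [measurable_cong] = \<pi>(1)
  have fm [measurable]: "f \<in> borel_measurable \<pi>" and fi: "integrable \<pi> (\<lambda>x. \<bar>f x\<bar> powr p)"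
    using f by (auto simp: Lp_def)
  define t where "t n x = max (- real n) (min (real n) (f x))" for n x
  have [measurable]: "t n \<in> borel_measurable \<pi>" for n
    unfolding t_def by measurable
  have le: "\<bar>f x - t n x\<bar> \<le> \<bar>f x\<bar>" for n x by (auto simp: t_def)
  have "(\<lambda>n. \<integral>x. \<bar>f x - t n x\<bar> powr p \<partial>\<pi>) \<longlonglongrightarrow> (\<integral>x. 0 \<partial>\<pi>)"
  proof (rule integral_dominated_convergence[where w = "\<lambda>x. \<bar>f x\<bar> powr p"])
    show "AE x in \<pi>. (\<lambda>n. \<bar>f x - t n x\<bar> powr p) \<longlonglongrightarrow> 0"
    proof (rule AE_I2)
      fix x
      obtain N :: nat where "\<bar>f x\<bar> \<le> real N" using real_arch_simple by blast
      then have "\<bar>f x - t n x\<bar> powr p = 0" if "N \<le> n" for n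
      proof -
        have "\<bar>f x\<bar> \<le> real n" using \<open>\<bar>f x\<bar> \<le> real N\<close> that by linarith
        then show ?thesis by (auto simp: t_def max_def min_def)
      qed
      then show "(\<lambda>n. \<bar>f x - t n x\<bar> powr p) \<longlonglongrightarrow> 0"
        by (intro tendsto_eventually) (auto simp: eventually_sequentially)
    qed
    show "AE x in \<pi>. norm (\<bar>f x - t n x\<bar> powr p) \<le> \<bar>f x\<bar> powr p" for n
      using le[of _ n] p by (intro AE_I2) (auto intro!: powr_mono2)
  qed (use fi in auto)
  \<comment> \<open>Truncation and approximation contribute less than \<open>e'\<close> each, and
    \<open>abs_add_powr_le\<close> multiplies their sum by \<open>2 powr p\<close>.\<close>
  moreover define e' where "e' = e / (2 * 2 powr p)"
  moreover have "0 < e'" using \<open>0 < e\<close> by (simp add: e'_def)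
  ultimately have "eventually (\<lambda>n. (\<integral>x. \<bar>f x - t n x\<bar> powr p \<partial>\<pi>) < e') sequentially"
    by (intro order_tendstoD(2)) auto
  then obtain n where n: "(\<integral>x. \<bar>f x - t n x\<bar> powr p \<partial>\<pi>) < e'"
    by (auto simp: eventually_sequentially)
  have tb: "\<bar>t n x\<bar> \<le> n" for x by (auto simp: t_def)
  then have ti: "integrable \<pi> (t n)"
    by (intro integrable_bounded) auto
  \<comment> \<open>The summand 1 keeps \<open>c\<close> positive when \<open>n = 0\<close>.\<close>
  define c where "c = (2 * real n) powr (p - 1) + 1"
  have "0 < c" by (simp add: c_def add_nonneg_pos)
  then have "0 < e' / c" using \<open>0 < e'\<close> by simp
  from L1_bounded_lipschitz_approx[OF \<pi> ti this]
  obtain g0 where g0: "bounded_lipschitz g0" "(\<integral>x. \<bar>t n x - g0 x\<bar> \<partial>\<pi>) < e' / c" by blast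
  define g where "g x = max (- real n) (min (real n) (g0 x))" for x
  have g: "bounded_lipschitz g"
    unfolding g_def using g0(1) by (intro bounded_lipschitz_clamp) auto
  note [measurable] = bounded_lipschitz_measurable[OF g0(1)] bounded_lipschitz_measurable[OF g]
  have gb: "\<bar>g x\<bar> \<le> n" for x by (auto simp: g_def)
  have pw: "\<bar>t n x - g x\<bar> powr p \<le> c * \<bar>t n x - g0 x\<bar>" for x
  proof -
    have "\<bar>t n x - g x\<bar> powr p = \<bar>t n x - g x\<bar> powr (p - 1) * \<bar>t n x - g x\<bar>"
      by (cases "t n x = g x") (auto simp: powr_diff)
    also have "\<dots> \<le> c * \<bar>t n x - g x\<bar>"
    proof (rule mult_right_mono)
      have "\<bar>t n x - g x\<bar> powr (p - 1) \<le> (2 * real n) powr (p - 1)"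
        using p tb[of x] gb[of x] by (intro powr_mono2) linarith+
      then show "\<bar>t n x - g x\<bar> powr (p - 1) \<le> c" by (simp add: c_def)
    qed auto
    also have "\<dots> \<le> c * \<bar>t n x - g0 x\<bar>"
    proof (rule mult_left_mono)
      \<comment> \<open>Clamping is a projection onto \<open>[-n, n]\<close>, and
        \<open>t n x\<close> already lies in that interval.\<close>
      show "\<bar>t n x - g x\<bar> \<le> \<bar>t n x - g0 x\<bar>"
        by (simp add: t_def g_def max_def min_def)
    qed (use \<open>0 < c\<close> in simp)
    finally show ?thesis .
  qed
  from g0(1) obtain K where K: "\<And>x. \<bar>g0 x\<bar> \<le> K" by (auto simp: bounded_lipschitz_def)
  have i0: "integrable \<pi> (\<lambda>x. \<bar>t n x - g0 x\<bar>)"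
    using ti integrable_bounded[of g0 K] K by auto
  have i1: "integrable \<pi> (\<lambda>x. \<bar>f x - t n x\<bar> powr p)"
    using le[of _ n] p
    by (intro Bochner_Integration.integrable_bound[OF fi]) (auto intro!: AE_I2 powr_mono2)
  have i2: "integrable \<pi> (\<lambda>x. \<bar>t n x - g x\<bar> powr p)"
    using pw by (intro Bochner_Integration.integrable_bound[OF integrable_mult_right[OF i0, of c]])
      (auto intro!: AE_I2 order_trans[OF _ abs_ge_self])
  have "(\<integral>x. \<bar>f x - g x\<bar> powr p \<partial>\<pi>) \<le>
      (\<integral>x. 2 powr p * (\<bar>f x - t n x\<bar> powr p + \<bar>t n x - g x\<bar> powr p) \<partial>\<pi>)"
  proof (rule integral_mono')
    show "\<bar>f x - g x\<bar> powr p \<le> 2 powr p * (\<bar>f x - t n x\<bar> powr p + \<bar>t n x - g x\<bar> powr p)" for x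
      using abs_add_powr_le[of p "f x - t n x" "t n x - g x"] p by simp
  qed (use i1 i2 in auto)
  also have "\<dots> = 2 powr p * ((\<integral>x. \<bar>f x - t n x\<bar> powr p \<partial>\<pi>) + (\<integral>x. \<bar>t n x - g x\<bar> powr p \<partial>\<pi>))"
    using i1 i2 by simp
  also have "(\<integral>x. \<bar>t n x - g x\<bar> powr p \<partial>\<pi>) \<le> (\<integral>x. c * \<bar>t n x - g0 x\<bar> \<partial>\<pi>)"
    using i0 i2 pw by (intro integral_mono) auto
  also have "\<dots> = c * (\<integral>x. \<bar>t n x - g0 x\<bar> \<partial>\<pi>)" by simp
  also have "\<dots> < e'"
    using g0(2) \<open>0 < c\<close> by (simp add: pos_less_divide_eq mult.commute)
  finally have "(\<integral>x. \<bar>f x - g x\<bar> powr p \<partial>\<pi>) < 2 powr p * ((\<integral>x. \<bar>f x - t n x\<bar> powr p \<partial>\<pi>) + e')"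
    by simp
  also have "\<dots> < 2 powr p * (e' + e')"
    using n by simp
  also have "\<dots> = e" by (simp add: e'_def)
  finally show ?thesis using g that by blast
qed

section \<open>The Wasserstein distance\<close>

text \<open>An infimum bounded by 1 only yields Lipschitz constants below \<open>1 + e\<close> for
  every positive \<open>e\<close>. The constant 1 itself is obtained pointwise, by letting
  \<open>e\<close> tend to 0 at fixed \<open>x\<close> and \<open>y\<close>.\<close>

lemma lip_seminorm_le_1_iff:
  fixes f :: "'a::metric_space \<Rightarrow> real"
  shows "f \<in> Lip \<and> lip_seminorm f \<le> 1 \<longleftrightarrow> 1-lipschitz_on UNIV f"
proof safe
  assume "f \<in> Lip" and le: "lip_seminorm f \<le> 1"
  then have ne: "{L. L-lipschitz_on UNIV f} \<noteq> {}" by (auto simp: Lip_def)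
  show "1-lipschitz_on UNIV f"
  proof (rule lipschitz_onI)
    fix x y
    have "dist (f x) (f y) \<le> (1 + e) * dist x y" if "0 < e" for e
    proof -
      have "Inf {L. L-lipschitz_on UNIV f} < 1 + e"
        using le that by (simp add: lip_seminorm_def)
      then obtain L where "L-lipschitz_on UNIV f" "L < 1 + e"
        using cInf_lessD[OF ne] by blast
      then show ?thesis
        by (meson UNIV_I less_imp_le lipschitz_onD lipschitz_on_mono order_refl)
    qed
    then have "dist (f x) (f y) \<le> dist x y + e" if "0 < e" for e
    proof -
      \<comment> \<open>The excess is scaled so that its product with \<open>dist x y\<close> stays
        below \<open>e\<close>, also when the two points coincide.\<close>
      have "0 < e / (dist x y + 1)" using that by (auto intro!: divide_pos_pos add_nonneg_pos)
      from \<open>\<And>e. 0 < e \<Longrightarrow> dist (f x) (f y) \<le> (1 + e) * dist x y\<close>[OF this]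
      have "dist (f x) (f y) \<le> dist x y + e * (dist x y / (dist x y + 1))"
        by (simp add: algebra_simps)
      also have "\<dots> \<le> dist x y + e * 1"
        using that by (intro add_left_mono mult_left_mono) (auto simp: divide_le_eq_1 add_nonneg_pos)
      finally show ?thesis by simp
    qed
    then show "dist (f x) (f y) \<le> 1 * dist x y"
      by (simp add: field_le_epsilon)
  qed simp
next
  assume "1-lipschitz_on UNIV f"
  then show "f \<in> Lip" "lip_seminorm f \<le> 1"
    by (auto simp: Lip_def lip_seminorm_def intro!: cInf_lower bdd_belowI[of _ 0] lipschitz_on_nonneg)
qed

lemma wasserstein_eq:
  "wasserstein \<mu> \<nu> = (SUP f \<in> {f. 1-lipschitz_on UNIV f}. \<bar>(\<integral>x. f x \<partial>\<mu>) - (\<integral>x. f x \<partial>\<nu>)\<bar>)"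
  by (simp add: wasserstein_def lip_seminorm_le_1_iff)

text \<open>The maximum of 0 and finitely many cones with apex \<open>q\<close> and height
  \<open>r\<close>. Encoding the finite family as a list makes the collection countable once heights
  and apexes range over countable sets.\<close>

definition cone_max :: "(real \<times> 'a::metric_space) list \<Rightarrow> 'a \<Rightarrow> real" where
  "cone_max l x = foldr (\<lambda>(r, q) a. max a (r - dist x q)) l 0"

lemma cone_max_lipschitz: "1-lipschitz_on UNIV (cone_max l)"
proof (induction l)
  case Nil
  show ?case unfolding cone_max_def by (auto intro: lipschitz_on_mono[OF lipschitz_on_constant])
next
  case (Cons rq l)
  obtain r q where rq: "rq = (r, q)" by force
  have "1-lipschitz_on UNIV (\<lambda>x. r - dist x q)"
    by (rule lipschitz_onI) (auto simp: dist_real_def, metis abs_dist_diff_le abs_minus_commute dist_commute)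
  from lipschitz_on_max_real[OF Cons this] show ?case by (simp add: cone_max_def rq)
qed

lemma cone_max_nonneg: "0 \<le> cone_max l x"
  by (induction l) (auto simp: cone_max_def)

lemma cone_max_ge: "(r, q) \<in> set l \<Longrightarrow> r - dist x q \<le> cone_max l x"
  by (induction l) (auto simp: cone_max_def le_max_iff_disj)

lemma cone_max_le:
  "0 \<le> b \<Longrightarrow> (\<And>r q. (r, q) \<in> set l \<Longrightarrow> r - dist x q \<le> b) \<Longrightarrow> cone_max l x \<le> b"
  by (induction l) (auto simp: cone_max_def)

text \<open>A nonnegative 1-Lipschitz \<open>f\<close> is the pointwise supremum of the cones \<open>f q - dist x q\<close> with \<open>q\<close>
  in a countable dense set; rational heights make the approximating family countable.\<close>

lemma lipschitz_cone_limit: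
  fixes f :: "'a::metric_space \<Rightarrow> real"
  assumes D: "countable D" "D \<noteq> {}" "closure D = UNIV"
    and f: "1-lipschitz_on UNIV f" "\<And>x. 0 \<le> f x"
  obtains l where "\<And>n::nat. l n \<in> lists (\<rat> \<times> D)" "\<And>n x. cone_max (l n) x \<le> f x"
    "\<And>x. (\<lambda>n. cone_max (l n) x) \<longlonglongrightarrow> f x"
proof -
  define q where "q = from_nat_into D"
  have qD: "range q = D" unfolding q_def by (rule range_from_nat_into[OF D(2,1)])
  \<comment> \<open>Heights strictly below \<open>f (q i)\<close> keep every cone under
    \<open>f\<close>; the heights improve with \<open>n\<close> while more apexes are added.\<close>
  have "\<exists>r\<in>\<rat>. f (q i) - 1 / Suc n < r \<and> r < f (q i)" for i n
    by (rule Rats_dense_in_real) auto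
  then obtain r where r: "\<And>i n. r i n \<in> \<rat>" "\<And>i n. f (q i) - 1 / Suc n < r i n" "\<And>i n. r i n < f (q i)"
    by metis
  define l where "l n = map (\<lambda>i. (r i n, q i)) [0..<n]" for n
  have lD: "l n \<in> lists (\<rat> \<times> D)" for n
    using r(1) qD by (auto simp: l_def)
  have f1: "f y - dist x y \<le> f x" for x y
    using lipschitz_onD[OF f(1), of x y] by (simp add: dist_real_def dist_commute)
  have up: "cone_max (l n) x \<le> f x" for n x
  proof (rule cone_max_le[OF f(2)])
    fix s y assume "(s, y) \<in> set (l n)"
    then obtain i where "s = r i n" "y = q i" by (auto simp: l_def)
    with r(3)[of i n] f1[of "q i" x] show "s - dist x y \<le> f x" by simp
  qed
  have "(\<lambda>n. cone_max (l n) x) \<longlonglongrightarrow> f x" for x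
  proof (rule LIMSEQ_I)
    fix e :: real assume "0 < e"
    \<comment> \<open>The distance from \<open>x\<close> to the apex is lost twice, once in
      comparing \<open>f x\<close> with \<open>f (q i)\<close> and once along the cone, and the
      height loses at most \<open>1 / Suc N\<close>. Three errors below \<open>e / 4\<close> stay
      below \<open>e\<close>.\<close>
    have "x \<in> closure D" using D(3) by simp
    then obtain y where "y \<in> D" "dist y x < e / 4"
      using \<open>0 < e\<close> closure_approachable[of x D] by (metis zero_less_divide_iff zero_less_numeral)
    then obtain i where i: "dist (q i) x < e / 4" using qD by (metis imageE)
    obtain N where N: "1 / Suc N < e / 4"
      using nat_approx_posE[of "e / 4"] \<open>0 < e\<close> by (metis zero_less_divide_iff zero_less_numeral)
    have "norm (cone_max (l n) x - f x) < e" if n: "max (Suc i) N \<le> n" for n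
    proof -
      have "(r i n, q i) \<in> set (l n)" using n by (auto simp: l_def)
      then have "r i n - dist x (q i) \<le> cone_max (l n) x" by (rule cone_max_ge)
      moreover have "1 / real (Suc n) \<le> 1 / real (Suc N)" using n by (intro divide_left_mono) auto
      ultimately show ?thesis
        using r(2)[of i n] up[of n x] f1[of x "q i"] i N by (simp add: dist_commute)
    qed
    then show "\<exists>no. \<forall>n\<ge>no. norm (cone_max (l n) x - f x) < e" by blast
  qed
  with lD up that show ?thesis by blast
qed

section \<open>Spaces of diameter at most one\<close>

context
  assumes diam: "\<And>x y :: 'a::polish_space. dist x y \<le> 1"
begin

lemma lipschitz_imp_bounded_lipschitz:
  fixes f :: "'a \<Rightarrow> real"
  assumes f: "L-lipschitz_on UNIV f"
  shows "bounded_lipschitz f"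
proof -
  have "\<bar>f x\<bar> \<le> \<bar>f undefined\<bar> + L" for x
  proof -
    have "dist (f x) (f undefined) \<le> L * dist x undefined"
      using lipschitz_onD[OF f] by simp
    also have "\<dots> \<le> L * 1"
      using lipschitz_on_nonneg[OF f] diam by (intro mult_left_mono) auto
    finally show ?thesis by (simp add: dist_real_def)
  qed
  with f show ?thesis unfolding bounded_lipschitz_def by blast
qed

lemma integrable_lipschitz:
  fixes f :: "'a \<Rightarrow> real"
  assumes "L-lipschitz_on UNIV f" "prob_space \<mu>" and [measurable_cong]: "sets \<mu> = sets borel"
  shows "integrable \<mu> f"
proof -
  interpret prob_space \<mu> by fact
  note [measurable] = lipschitz_on_borel_measurable[OF assms(1)]
  obtain K where "\<And>x. \<bar>f x\<bar> \<le> K"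
    using lipschitz_imp_bounded_lipschitz[OF assms(1)] by (auto simp: bounded_lipschitz_def)
  then show ?thesis by (intro integrable_bounded) auto
qed

text \<open>On a space of diameter at most 1, such an \<open>f\<close> oscillates by at most 1;
  integrate this in one variable and then in the other. The bound is what makes the real suprema
  below behave as suprema.\<close>

lemma lipschitz_integral_diff_le_1:
  fixes f :: "'a \<Rightarrow> real"
  assumes f: "1-lipschitz_on UNIV f" and \<mu>: "prob_space \<mu>" "sets \<mu> = sets borel"
    and \<nu>: "prob_space \<nu>" "sets \<nu> = sets borel"
  shows "\<bar>(\<integral>x. f x \<partial>\<mu>) - (\<integral>x. f x \<partial>\<nu>)\<bar> \<le> 1"
proof -
  interpret mu: prob_space \<mu> by fact
  interpret nu: prob_space \<nu> by fact
  have fb: "\<bar>f x - f y\<bar> \<le> 1" for x y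
    using lipschitz_onD[OF f, of x y] diam[of x y] by (simp add: dist_real_def)
  have i: "integrable \<mu> f" "integrable \<nu> f"
    using integrable_lipschitz[OF f] \<mu> \<nu> by auto
  have "\<bar>f y - (\<integral>x. f x \<partial>\<nu>)\<bar> \<le> 1" for y
  proof -
    have "f y - (\<integral>x. f x \<partial>\<nu>) = (\<integral>x. f y - f x \<partial>\<nu>)"
      using i by (simp add: nu.prob_space)
    also have "\<bar>\<dots>\<bar> \<le> (\<integral>x. 1 \<partial>\<nu>)"
      using i fb by (intro integral_abs_bound[THEN order_trans] integral_mono) auto
    finally show ?thesis by (simp add: nu.prob_space)
  qed
  then have "\<bar>\<integral>y. f y - (\<integral>x. f x \<partial>\<nu>) \<partial>\<mu>\<bar> \<le> (\<integral>x. 1 \<partial>\<mu>)"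
    using i by (intro integral_abs_bound[THEN order_trans] integral_mono) auto
  then show ?thesis using i by (simp add: mu.prob_space)
qed

lemma wasserstein_bdd_above:
  fixes \<mu> \<nu> :: "'a measure"
  assumes "prob_space \<mu>" "sets \<mu> = sets borel" "prob_space \<nu>" "sets \<nu> = sets borel"
  shows "bdd_above ((\<lambda>f. \<bar>(\<integral>x. f x \<partial>\<mu>) - (\<integral>x. f x \<partial>\<nu>)\<bar>) ` {f :: 'a \<Rightarrow> real. 1-lipschitz_on UNIV f})"
  using lipschitz_integral_diff_le_1[OF _ assms] by (intro bdd_aboveI2[of _ _ 1]) auto

lemma wasserstein_le_1:
  fixes \<mu> \<nu> :: "'a measure"
  assumes "prob_space \<mu>" "sets \<mu> = sets borel" "prob_space \<nu>" "sets \<nu> = sets borel"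
  shows "wasserstein \<mu> \<nu> \<le> 1"
  unfolding wasserstein_eq
proof (rule cSUP_least)
  have "1-lipschitz_on UNIV (\<lambda>_ :: 'a. 0 :: real)"
    by (rule lipschitz_on_mono[OF lipschitz_on_constant]) auto
  then show "{f. 1-lipschitz_on UNIV (f :: 'a \<Rightarrow> real)} \<noteq> {}" by blast
qed (use lipschitz_integral_diff_le_1[OF _ assms] in auto)

lemma wasserstein_nonneg:
  fixes \<mu> \<nu> :: "'a measure"
  assumes "prob_space \<mu>" "sets \<mu> = sets borel" "prob_space \<nu>" "sets \<nu> = sets borel"
  shows "0 \<le> wasserstein \<mu> \<nu>"
  unfolding wasserstein_eq
  by (rule cSUP_upper2[OF wasserstein_bdd_above[OF assms], where x = "\<lambda>_. 0"])
     (auto intro: lipschitz_on_mono[OF lipschitz_on_constant])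

lemma lipschitz_integral_diff_le:
  fixes f :: "'a \<Rightarrow> real"
  assumes f: "L-lipschitz_on UNIV f" and \<mu>: "prob_space \<mu>" "sets \<mu> = sets borel"
    and \<nu>: "prob_space \<nu>" "sets \<nu> = sets borel"
  shows "\<bar>(\<integral>x. f x \<partial>\<mu>) - (\<integral>x. f x \<partial>\<nu>)\<bar> \<le> (L + 1) * wasserstein \<mu> \<nu>"
proof -
  have L: "0 \<le> L" by (rule lipschitz_on_nonneg[OF f])
  \<comment> \<open>Normalising by \<open>L + 1\<close> instead of \<open>L\<close> covers
    \<open>L = 0\<close> without a case split.\<close>
  have "(inverse (L + 1) * (L + 1))-lipschitz_on UNIV (\<lambda>x. inverse (L + 1) * f x)"
    using L by (intro lipschitz_on_cmult_real_nonneg lipschitz_on_mono[OF f]) auto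
  then have l: "1-lipschitz_on UNIV (\<lambda>x. inverse (L + 1) * f x)" using L by simp
  have "\<bar>(\<integral>x. inverse (L + 1) * f x \<partial>\<mu>) - (\<integral>x. inverse (L + 1) * f x \<partial>\<nu>)\<bar> \<le> wasserstein \<mu> \<nu>"
    unfolding wasserstein_eq
    using l by (intro cSUP_upper2[OF wasserstein_bdd_above[OF \<mu> \<nu>]]) auto
  also have "(\<integral>x. inverse (L + 1) * f x \<partial>\<mu>) - (\<integral>x. inverse (L + 1) * f x \<partial>\<nu>)
      = inverse (L + 1) * ((\<integral>x. f x \<partial>\<mu>) - (\<integral>x. f x \<partial>\<nu>))"
    by (simp add: right_diff_distrib)
  finally show ?thesis using L
    by (simp add: abs_mult inverse_eq_divide divide_le_eq mult.commute)
qed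

text \<open>Adding a constant to a test function does not change the difference of its integrals
  against two probability measures, so test functions may be taken nonnegative. Cone maxima then
  approximate them from below, and dominated convergence carries the integrals along.\<close>

lemma wasserstein_eq_countable:
  fixes \<mu> \<nu> :: "'a measure"
  assumes D: "countable D" "D \<noteq> {}" "closure D = UNIV"
    and \<mu>: "prob_space \<mu>" "sets \<mu> = sets borel" and \<nu>: "prob_space \<nu>" "sets \<nu> = sets borel"
  shows "wasserstein \<mu> \<nu> =
    (SUP l \<in> lists (\<rat> \<times> D). \<bar>(\<integral>x. cone_max l x \<partial>\<mu>) - (\<integral>x. cone_max l x \<partial>\<nu>)\<bar>)" (is "_ = ?S")
proof (rule antisym)
  interpret mu: prob_space \<mu> by fact
  interpret nu: prob_space \<nu> by fact
  let ?d = "\<lambda>f. \<bar>(\<integral>x. f x \<partial>\<mu>) - (\<integral>x. f x \<partial>\<nu>)\<bar>"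
  note bdd = wasserstein_bdd_above[OF \<mu> \<nu>]
  have bdd': "bdd_above ((\<lambda>l. ?d (cone_max l)) ` lists (\<rat> \<times> D))"
    using lipschitz_integral_diff_le_1[OF cone_max_lipschitz \<mu> \<nu>] by (intro bdd_aboveI2[of _ _ 1]) auto
  show "?S \<le> wasserstein \<mu> \<nu>"
    unfolding wasserstein_eq
    by (intro cSUP_least cSUP_upper2[OF bdd]) (auto simp: cone_max_lipschitz)
  have pos: "?d f \<le> ?S" if f: "1-lipschitz_on UNIV f" "\<And>x. 0 \<le> f x" for f
  proof -
    obtain l where l: "\<And>n::nat. l n \<in> lists (\<rat> \<times> D)" "\<And>n x. cone_max (l n) x \<le> f x"
      "\<And>x. (\<lambda>n. cone_max (l n) x) \<longlonglongrightarrow> f x"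
      using lipschitz_cone_limit[OF D f] by blast
    have conv: "(\<lambda>n. \<integral>x. cone_max (l n) x \<partial>\<kappa>) \<longlonglongrightarrow> (\<integral>x. f x \<partial>\<kappa>)"
      if \<kappa>: "prob_space \<kappa>" "sets \<kappa> = sets borel" for \<kappa>
    proof (rule integral_dominated_convergence[where w = f])
      show "cone_max (l n) \<in> borel_measurable \<kappa>" for n
        using lipschitz_on_borel_measurable[OF cone_max_lipschitz] \<kappa>(2)
        by (simp cong: measurable_cong_sets)
      show "integrable \<kappa> f" using integrable_lipschitz[OF f(1) \<kappa>] .
      then show "f \<in> borel_measurable \<kappa>" by simp
      show "AE x in \<kappa>. norm (cone_max (l n) x) \<le> f x" for n
        using l(2) by (intro AE_I2) (simp add: cone_max_nonneg)
      show "AE x in \<kappa>. (\<lambda>n. cone_max (l n) x) \<longlonglongrightarrow> f x"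
        by (intro AE_I2 l(3))
    qed
    have "(\<lambda>n. ?d (cone_max (l n))) \<longlonglongrightarrow> ?d f"
      by (intro tendsto_rabs tendsto_diff conv \<mu> \<nu>)
    then show ?thesis
      by (rule LIMSEQ_le_const2) (intro exI[of _ 0] allI impI cSUP_upper bdd' l(1))
  qed
  show "wasserstein \<mu> \<nu> \<le> ?S"
    unfolding wasserstein_eq
  proof (rule cSUP_least)
    show "{f. 1-lipschitz_on UNIV (f :: 'a \<Rightarrow> real)} \<noteq> {}"
      using cone_max_lipschitz by blast
    fix f :: "'a \<Rightarrow> real" assume "f \<in> {f. 1-lipschitz_on UNIV f}"
    then have f: "1-lipschitz_on UNIV f" by simp
    obtain K where K: "\<And>x. \<bar>f x\<bar> \<le> K"
      using lipschitz_imp_bounded_lipschitz[OF f] by (auto simp: bounded_lipschitz_def)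
    have "1-lipschitz_on UNIV (\<lambda>x. f x + K)"
      using lipschitz_on_add[OF f lipschitz_on_constant[of UNIV K]] by simp
    moreover have "0 \<le> f x + K" for x using K[of x] by linarith
    ultimately have "?d (\<lambda>x. f x + K) \<le> ?S" by (rule pos)
    then show "?d f \<le> ?S"
      using integrable_lipschitz[OF f] \<mu> \<nu> by (simp add: mu.prob_space nu.prob_space)
  qed
qed

lemma wasserstein_measurable:
  assumes \<kappa>: "\<kappa> \<in> N \<rightarrow>\<^sub>M prob_algebra (borel :: 'a measure)"
    and \<nu>: "prob_space \<nu>" "sets \<nu> = sets (borel :: 'a measure)"
  shows "(\<lambda>x. wasserstein (\<kappa> x) \<nu>) \<in> borel_measurable N"
proof -
  obtain D :: "'a set" where D0: "countable D" "\<And>X. open X \<Longrightarrow> X \<noteq> {} \<Longrightarrow> \<exists>d\<in>D. d \<in> X"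
    by (rule countable_dense_setE) blast
  have "closure D = UNIV"
    using D0(2)[of "- closure D"] closure_subset[of D] by (auto simp: closed_closure)
  with D0(1) have D: "countable D" "closure D = UNIV" by auto
  have ne: "D \<noteq> {}" using D(2) by auto
  have k: "prob_space (\<kappa> x)" "sets (\<kappa> x) = sets borel" if "x \<in> space N" for x
    using measurable_space[OF \<kappa> that] by (auto simp: space_prob_algebra)
  have [measurable]: "\<kappa> \<in> N \<rightarrow>\<^sub>M subprob_algebra borel" using \<kappa> by (rule measurable_prob_algebraD)
  have "(\<lambda>x. SUP l \<in> lists (\<rat> \<times> D). \<bar>(\<integral>y. cone_max l y \<partial>\<kappa> x) - (\<integral>y. cone_max l y \<partial>\<nu>)\<bar>) \<in> borel_measurable N"
  proof (rule borel_measurable_cSUP)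
    show "countable (lists (\<rat> \<times> D))"
      using D(1) by (intro countable_lists countable_SIGMA countable_rat)
    fix l
    note [measurable] = lipschitz_on_borel_measurable[OF cone_max_lipschitz[of l]]
    have "(\<lambda>x. integral\<^sup>L (\<kappa> x) (cone_max l)) \<in> borel_measurable N"
      by measurable
    then show "(\<lambda>x. \<bar>(\<integral>y. cone_max l y \<partial>\<kappa> x) - (\<integral>y. cone_max l y \<partial>\<nu>)\<bar>) \<in> borel_measurable N"
      by measurable
  next
    fix x assume "x \<in> space N"
    from lipschitz_integral_diff_le_1[OF cone_max_lipschitz k[OF this] \<nu>]
    show "bdd_above ((\<lambda>l. \<bar>(\<integral>y. cone_max l y \<partial>\<kappa> x) - (\<integral>y. cone_max l y \<partial>\<nu>)\<bar>) ` lists (\<rat> \<times> D))"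
      by (intro bdd_aboveI2[of _ _ 1]) auto
  qed
  then show ?thesis
    by (rule measurable_cong[THEN iffD1, rotated])
       (simp add: wasserstein_eq_countable[OF D(1) ne D(2) k \<nu>])
qed

end

section \<open>Moments of averages\<close>

text \<open>A pointwise form of Chebyshev's argument, valid for \<open>p\<close> on either side of
  2. Where \<open>\<bar>Y\<bar> \<le> d\<close> the p-th power is at most \<open>d powr p\<close>;
  elsewhere it is at most \<open>K powr p\<close>, hence at most \<open>K powr p\<close> times the
  square of \<open>Y / d\<close>, whose integral tends to 0.\<close>

lemma tendsto_moment_of_second_moment:
  fixes Y :: "'i \<Rightarrow> 'b \<Rightarrow> real"
  assumes Q: "prob_space Q" and p: "1 \<le> p"
    and Y: "\<forall>\<^sub>F t in G. Y t \<in> borel_measurable Q \<and> (\<forall>\<omega>\<in>space Q. \<bar>Y t \<omega>\<bar> \<le> K)"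
    and lim: "((\<lambda>t. \<integral>\<omega>. (Y t \<omega>)\<^sup>2 \<partial>Q) \<longlongrightarrow> 0) G"
  shows "((\<lambda>t. \<integral>\<omega>. \<bar>Y t \<omega>\<bar> powr p \<partial>Q) \<longlongrightarrow> 0) G"
proof (rule tendstoI)
  interpret prob_space Q by fact
  fix e :: real assume "0 < e"
  \<comment> \<open>The threshold at which small values contribute exactly
    \<open>e / 2\<close>.\<close>
  define d where "d = (e / 2) powr (1 / p)"
  have d: "0 < d" "d powr p = e / 2"
    using \<open>0 < e\<close> p by (auto simp: d_def powr_powr)
  define c where "c = K powr p / d\<^sup>2"
  have "((\<lambda>t. c * (\<integral>\<omega>. (Y t \<omega>)\<^sup>2 \<partial>Q)) \<longlongrightarrow> 0) G"
    using tendsto_mult[OF tendsto_const lim, of c] by simp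
  then have "\<forall>\<^sub>F t in G. c * (\<integral>\<omega>. (Y t \<omega>)\<^sup>2 \<partial>Q) < e / 2"
    using \<open>0 < e\<close> by (intro order_tendstoD(2)) auto
  then show "\<forall>\<^sub>F t in G. dist (\<integral>\<omega>. \<bar>Y t \<omega>\<bar> powr p \<partial>Q) 0 < e"
    using Y
  proof eventually_elim
    fix t assume t: "c * (\<integral>\<omega>. (Y t \<omega>)\<^sup>2 \<partial>Q) < e / 2"
      and "Y t \<in> borel_measurable Q \<and> (\<forall>\<omega>\<in>space Q. \<bar>Y t \<omega>\<bar> \<le> K)"
    then have [measurable]: "Y t \<in> borel_measurable Q" and b: "\<And>\<omega>. \<omega> \<in> space Q \<Longrightarrow> \<bar>Y t \<omega>\<bar> \<le> K"
      by auto
    have i2: "integrable Q (\<lambda>\<omega>. (Y t \<omega>)\<^sup>2)"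
    proof (rule integrable_bounded)
      fix \<omega> assume "\<omega> \<in> space Q"
      then show "\<bar>(Y t \<omega>)\<^sup>2\<bar> \<le> K\<^sup>2"
        using power_mono[OF b, of \<omega> 2] by simp
    qed measurable
    have pw: "\<bar>Y t \<omega>\<bar> powr p \<le> d powr p + c * (Y t \<omega>)\<^sup>2" if "\<omega> \<in> space Q" for \<omega>
    proof (cases "\<bar>Y t \<omega>\<bar> \<le> d")
      case True
      then have "\<bar>Y t \<omega>\<bar> powr p \<le> d powr p" using p by (intro powr_mono2) auto
      then show ?thesis by (simp add: c_def add_increasing2)
    next
      case False
      have "\<bar>Y t \<omega>\<bar> powr p \<le> K powr p * 1" using p b[OF that] by (simp add: powr_mono2)
      also have "\<dots> \<le> K powr p * ((Y t \<omega>)\<^sup>2 / d\<^sup>2)"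
        using False d(1) power_mono[of d "\<bar>Y t \<omega>\<bar>" 2] by (intro mult_left_mono) (auto simp: le_divide_eq)
      finally show ?thesis by (simp add: c_def add_increasing)
    qed
    have "(\<integral>\<omega>. \<bar>Y t \<omega>\<bar> powr p \<partial>Q) \<le> (\<integral>\<omega>. d powr p + c * (Y t \<omega>)\<^sup>2 \<partial>Q)"
      using pw i2 by (intro integral_mono') (auto simp: c_def)
    also have "\<dots> = e / 2 + c * (\<integral>\<omega>. (Y t \<omega>)\<^sup>2 \<partial>Q)"
      using i2 d(2) by (simp add: prob_space)
    finally show "dist (\<integral>\<omega>. \<bar>Y t \<omega>\<bar> powr p \<partial>Q) 0 < e"
      using t by simp
  qed
qed

text \<open>The second moment of an average is the double average of the correlations of
  \<open>h s\<close> and \<open>h r\<close>. Outside \<open>N s\<close> they are at most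
  \<open>\<delta>\<close>; on \<open>N s\<close>, of mass at most \<open>\<eta>\<close>, only the
  trivial bound, the square of \<open>K\<close>, is used.\<close>

lemma average_second_moment_le:
  fixes h :: "'s \<Rightarrow> 'b \<Rightarrow> real"
  assumes U: "prob_space U" and Q: "prob_space Q"
    and h [measurable]: "case_prod h \<in> borel_measurable (U \<Otimes>\<^sub>M Q)"
    and hK: "\<And>s \<omega>. s \<in> space U \<Longrightarrow> \<omega> \<in> space Q \<Longrightarrow> \<bar>h s \<omega>\<bar> \<le> K"
    and N: "\<And>s. s \<in> space U \<Longrightarrow> N s \<in> sets U" "\<And>s. s \<in> space U \<Longrightarrow> measure U (N s) \<le> \<eta>"
    and cov: "\<And>s r. s \<in> space U \<Longrightarrow> r \<in> space U \<Longrightarrow> r \<notin> N s \<Longrightarrow> \<bar>\<integral>\<omega>. h s \<omega> * h r \<omega> \<partial>Q\<bar> \<le> \<delta>"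
    and "0 \<le> \<delta>"
  shows "(\<integral>\<omega>. (\<integral>s. h s \<omega> \<partial>U)\<^sup>2 \<partial>Q) \<le> \<delta> + K\<^sup>2 * \<eta>"
proof -
  interpret U: prob_space U by fact
  interpret Q: prob_space Q by fact
  interpret UQ: pair_prob_space U Q ..
  define Y where "Y \<omega> = (\<integral>s. h s \<omega> \<partial>U)" for \<omega>
  have [measurable]: "Y \<in> borel_measurable Q" unfolding Y_def by measurable
  have hi: "integrable U (\<lambda>s. h s \<omega>)" if "\<omega> \<in> space Q" for \<omega>
    using that hK by (intro U.integrable_bounded[of _ K]) auto
  have YK: "\<bar>Y \<omega>\<bar> \<le> K" if "\<omega> \<in> space Q" for \<omega>
  proof -
    have "\<bar>Y \<omega>\<bar> \<le> (\<integral>s. \<bar>h s \<omega>\<bar> \<partial>U)" unfolding Y_def by (rule integral_abs_bound)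
    also have "\<dots> \<le> (\<integral>s. K \<partial>U)" using hi[OF that] hK that by (intro integral_mono) auto
    finally show ?thesis by (simp add: U.prob_space)
  qed
  \<comment> \<open>A single sample point shows that \<open>K\<close> bounds an absolute value and
    is therefore nonnegative.\<close>
  obtain s0 \<omega>0 where "s0 \<in> space U" "\<omega>0 \<in> space Q"
    using U.not_empty Q.not_empty by auto
  with hK have K0: "0 \<le> K" by (meson abs_ge_zero order_trans)
  have hYi: "integrable (U \<Otimes>\<^sub>M Q) (\<lambda>(s, \<omega>). h s \<omega> * Y \<omega>)"
    using hK YK K0
    by (intro UQ.P.integrable_bounded[of _ "K * K"])
       (auto simp: space_pair_measure abs_mult intro!: mult_mono)
  have hhK: "\<bar>h s \<omega> * h r \<omega>\<bar> \<le> K\<^sup>2" if "s \<in> space U" "r \<in> space U" "\<omega> \<in> space Q" for s r \<omega>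
    using hK[OF that(1,3)] hK[OF that(2,3)] K0
    by (auto simp: abs_mult power2_eq_square intro!: mult_mono)
  have bound: "\<bar>\<integral>\<omega>. h s \<omega> * Y \<omega> \<partial>Q\<bar> \<le> \<delta> + K\<^sup>2 * \<eta>" if s: "s \<in> space U" for s
  proof -
    note [measurable] = N(1)[OF s]
    have [measurable]: "h s \<in> borel_measurable Q"
      using measurable_Pair2[OF h s] by simp
    have hhi: "integrable (U \<Otimes>\<^sub>M Q) (\<lambda>(r, \<omega>). h s \<omega> * h r \<omega>)"
      using hhK[OF s] by (intro UQ.P.integrable_bounded[of _ "K\<^sup>2"]) (auto simp: space_pair_measure)
    have "(\<integral>\<omega>. h s \<omega> * Y \<omega> \<partial>Q) = (\<integral>\<omega>. \<integral>r. h s \<omega> * h r \<omega> \<partial>U \<partial>Q)"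
      by (simp add: Y_def)
    also have "\<dots> = (\<integral>r. \<integral>\<omega>. h s \<omega> * h r \<omega> \<partial>Q \<partial>U)"
      by (rule UQ.Fubini_integral[OF hhi])
    also have "\<bar>\<dots>\<bar> \<le> (\<integral>r. \<bar>\<integral>\<omega>. h s \<omega> * h r \<omega> \<partial>Q\<bar> \<partial>U)"
      by (rule integral_abs_bound)
    also have "\<dots> \<le> (\<integral>r. \<delta> + K\<^sup>2 * indicator (N s) r \<partial>U)"
    proof (rule integral_mono')
      show "integrable U (\<lambda>r. \<delta> + K\<^sup>2 * indicator (N s) r)"
        by (auto simp: less_top[symmetric])
      fix r assume r: "r \<in> space U"
      have [measurable]: "h r \<in> borel_measurable Q"
        using measurable_Pair2[OF h r] by simp
      have "\<bar>\<integral>\<omega>. h s \<omega> * h r \<omega> \<partial>Q\<bar> \<le> (\<integral>\<omega>. K\<^sup>2 \<partial>Q)"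
        using hhK[OF s r] by (intro integral_abs_bound[THEN order_trans] integral_mono')  auto
      then show "\<bar>\<integral>\<omega>. h s \<omega> * h r \<omega> \<partial>Q\<bar> \<le> \<delta> + K\<^sup>2 * indicator (N s) r"
        using cov[OF s r] \<open>0 \<le> \<delta>\<close> by (cases "r \<in> N s") (auto simp: Q.prob_space)
    qed (use \<open>0 \<le> \<delta>\<close> in auto)
    also have "\<dots> = \<delta> + K\<^sup>2 * measure U (N s)"
      by (simp add: U.prob_space less_top[symmetric])
    also have "\<dots> \<le> \<delta> + K\<^sup>2 * \<eta>" using N(2)[OF s] by (simp add: mult_left_mono)
    finally show ?thesis .
  qed
  \<comment> \<open>Only one factor of the square is expanded here; the other was expanded in
    \<open>bound\<close> with \<open>s\<close> fixed. Two applications of Fubini on \<open>U\<close>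
    times \<open>Q\<close> thus replace one on a triple product.\<close>
  have "(\<integral>\<omega>. (Y \<omega>)\<^sup>2 \<partial>Q) = (\<integral>\<omega>. \<integral>s. h s \<omega> * Y \<omega> \<partial>U \<partial>Q)"
    by (simp add: power2_eq_square Y_def)
  also have "\<dots> = (\<integral>s. \<integral>\<omega>. h s \<omega> * Y \<omega> \<partial>Q \<partial>U)"
    by (rule UQ.Fubini_integral[OF hYi])
  also have "\<dots> \<le> (\<integral>s. \<delta> + K\<^sup>2 * \<eta> \<partial>U)"
  proof (rule integral_mono)
    show "integrable U (\<lambda>s. \<integral>\<omega>. h s \<omega> * Y \<omega> \<partial>Q)"
      using UQ.integrable_fst[OF hYi] by simp
  qed (use bound in \<open>auto simp: abs_le_iff\<close>)
  finally show ?thesis by (simp add: Y_def U.prob_space)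
qed

text \<open>\<open>U\<close> is the law of a random time chosen independently of the sample point,
  and \<open>m\<close> is a process all of whose one-time laws are \<open>\<pi>\<close>. It is
  instantiated with the uniform law on an initial stretch of time, the stationary path measure and
  the Markov process.\<close>

locale stationary_average =
  U: prob_space U + Q: prob_space Q + \<pi>: prob_space \<pi>
  for U :: "'s measure" and Q :: "'b measure" and \<pi> :: "'a measure" and m :: "'s \<Rightarrow> 'b \<Rightarrow> 'a" +
  assumes m [measurable]: "case_prod m \<in> U \<Otimes>\<^sub>M Q \<rightarrow>\<^sub>M \<pi>"
    and stationary: "\<And>s. s \<in> space U \<Longrightarrow> distr Q \<pi> (m s) = \<pi>"
begin

sublocale UQ: pair_prob_space U Q ..

text \<open>Observing the process at an independent random time gives a mixture of its one-time
  laws, and all of these are \<open>\<pi>\<close>.\<close>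

lemma distr_pair: "distr (U \<Otimes>\<^sub>M Q) \<pi> (case_prod m) = \<pi>"
proof (rule measure_eqI)
  fix B assume "B \<in> sets (distr (U \<Otimes>\<^sub>M Q) \<pi> (case_prod m))"
  then have [measurable]: "B \<in> sets \<pi>" by simp
  have "emeasure (distr (U \<Otimes>\<^sub>M Q) \<pi> (case_prod m)) B =
      emeasure (U \<Otimes>\<^sub>M Q) (case_prod m -` B \<inter> space (U \<Otimes>\<^sub>M Q))"
    by (rule emeasure_distr) measurable
  also have "\<dots> = (\<integral>\<^sup>+s. emeasure Q (Pair s -` (case_prod m -` B \<inter> space (U \<Otimes>\<^sub>M Q))) \<partial>U)"
    by (rule Q.emeasure_pair_measure_alt) measurable
  also have "\<dots> = (\<integral>\<^sup>+s. emeasure \<pi> B \<partial>U)"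
  proof (rule nn_integral_cong)
    fix s assume s: "s \<in> space U"
    have ms: "m s \<in> Q \<rightarrow>\<^sub>M \<pi>" using measurable_Pair2[OF m s] by simp
    have "Pair s -` (case_prod m -` B \<inter> space (U \<Otimes>\<^sub>M Q)) = m s -` B \<inter> space Q"
      using s by (auto simp: space_pair_measure)
    then show "emeasure Q (Pair s -` (case_prod m -` B \<inter> space (U \<Otimes>\<^sub>M Q))) = emeasure \<pi> B"
      using emeasure_distr[OF ms, of B] stationary[OF s] by simp
  qed
  finally show "emeasure (distr (U \<Otimes>\<^sub>M Q) \<pi> (case_prod m)) B = emeasure \<pi> B"
    by (simp add: U.emeasure_space_1)
qed simp

lemma integrable_pair:
  fixes f :: "'a \<Rightarrow> real"
  assumes "integrable \<pi> f"
  shows "integrable (U \<Otimes>\<^sub>M Q) (\<lambda>(s, \<omega>). f (m s \<omega>))"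
proof -
  have "integrable (distr (U \<Otimes>\<^sub>M Q) \<pi> (case_prod m)) f" using assms by (simp add: distr_pair)
  from integrable_distr[OF m this] show ?thesis by (simp add: case_prod_beta')
qed

lemma AE_integrable_average:
  fixes f :: "'a \<Rightarrow> real"
  assumes "integrable \<pi> f"
  shows "AE \<omega> in Q. integrable U (\<lambda>s. f (m s \<omega>))"
  by (rule UQ.AE_integrable_snd[OF integrable_pair[OF assms]])

lemma integral_average:
  fixes f :: "'a \<Rightarrow> real"
  assumes "integrable \<pi> f"
  shows "(\<integral>\<omega>. \<integral>s. f (m s \<omega>) \<partial>U \<partial>Q) = (\<integral>x. f x \<partial>\<pi>)"
proof -
  have "(\<integral>x. f x \<partial>\<pi>) = (\<integral>x. f x \<partial>distr (U \<Otimes>\<^sub>M Q) \<pi> (case_prod m))" by (simp add: distr_pair)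
  also have "\<dots> = (\<integral>(s, \<omega>). f (m s \<omega>) \<partial>(U \<Otimes>\<^sub>M Q))"
    using assms by (subst integral_distr) (auto simp: case_prod_beta')
  finally show ?thesis using UQ.integral_snd[OF integrable_pair[OF assms]] by simp
qed

lemma average_Lp:
  fixes f :: "'a \<Rightarrow> real"
  assumes p: "1 \<le> p" and f: "f \<in> Lp p \<pi>"
  shows "(\<lambda>\<omega>. \<integral>s. f (m s \<omega>) \<partial>U) \<in> Lp p Q"
    and "(\<integral>\<omega>. \<bar>\<integral>s. f (m s \<omega>) \<partial>U\<bar> powr p \<partial>Q) \<le> (\<integral>x. \<bar>f x\<bar> powr p \<partial>\<pi>)"
proof -
  have fm [measurable]: "f \<in> borel_measurable \<pi>" and fi: "integrable \<pi> (\<lambda>x. \<bar>f x\<bar> powr p)"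
    using f by (auto simp: Lp_def)
  have i: "integrable Q (\<lambda>\<omega>. \<integral>s. \<bar>f (m s \<omega>)\<bar> powr p \<partial>U)"
    using UQ.integrable_snd[OF integrable_pair[OF fi]] by simp
  \<comment> \<open>Jensen's inequality along a path needs \<open>\<bar>f\<bar> powr p\<close> to be
    integrable along that path, which Fubini provides only almost everywhere.\<close>
  have ae: "AE \<omega> in Q. \<bar>\<integral>s. f (m s \<omega>) \<partial>U\<bar> powr p \<le> (\<integral>s. \<bar>f (m s \<omega>)\<bar> powr p \<partial>U)"
    using AE_integrable_average[OF fi] AE_space
  proof eventually_elim
    fix \<omega> assume w: "integrable U (\<lambda>s. \<bar>f (m s \<omega>)\<bar> powr p)" "\<omega> \<in> space Q"
    have "(\<lambda>s. m s \<omega>) \<in> U \<rightarrow>\<^sub>M \<pi>" using measurable_Pair1[OF m w(2)] by simp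
    then have "(\<lambda>s. f (m s \<omega>)) \<in> borel_measurable U" by measurable
    from U.abs_expectation_powr_le[OF p this w(1)]
    show "\<bar>\<integral>s. f (m s \<omega>) \<partial>U\<bar> powr p \<le> (\<integral>s. \<bar>f (m s \<omega>)\<bar> powr p \<partial>U)" .
  qed
  have X [measurable]: "(\<lambda>\<omega>. \<integral>s. f (m s \<omega>) \<partial>U) \<in> borel_measurable Q"
    by measurable
  have iX: "integrable Q (\<lambda>\<omega>. \<bar>\<integral>s. f (m s \<omega>) \<partial>U\<bar> powr p)"
    using ae by (intro Bochner_Integration.integrable_bound[OF i]) (auto elim!: eventually_mono)
  then show "(\<lambda>\<omega>. \<integral>s. f (m s \<omega>) \<partial>U) \<in> Lp p Q" by (simp add: Lp_def X)
  have "(\<integral>\<omega>. \<bar>\<integral>s. f (m s \<omega>) \<partial>U\<bar> powr p \<partial>Q) \<le> (\<integral>\<omega>. \<integral>s. \<bar>f (m s \<omega>)\<bar> powr p \<partial>U \<partial>Q)"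
    by (rule integral_mono_AE[OF iX i ae])
  also have "\<dots> = (\<integral>x. \<bar>f x\<bar> powr p \<partial>\<pi>)" by (rule integral_average[OF fi])
  finally show "(\<integral>\<omega>. \<bar>\<integral>s. f (m s \<omega>) \<partial>U\<bar> powr p \<partial>Q) \<le> (\<integral>x. \<bar>f x\<bar> powr p \<partial>\<pi>)" .
qed

end

section \<open>Time averages\<close>

text \<open>\<open>time_measure\<close> tests \<open>T = \<nat>\<close> first, so evaluating it in
  continuous time requires \<open>{0..} \<noteq> \<nat>\<close>; the point 1/2 tells the two
  apart.\<close>

lemma time_setE:
  assumes "time_set T"
  obtains (discrete) "T = \<nat>" "time_measure T = count_space \<nat>"
  | (continuous) "T = {0..}" "time_measure T = restrict_space lborel {0..}"
proof -
  have "{0..} \<noteq> (\<nat> :: real set)"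
  proof
    assume "{0..} = (\<nat> :: real set)"
    then have "(1 / 2 :: real) \<in> \<nat>" by (metis atLeast_iff zero_le_divide_1_iff zero_le_numeral)
    then obtain n :: nat where "1 / 2 = real n" by (auto elim: Nats_cases)
    then have "real 1 = real (2 * n)" by simp
    then have "1 = 2 * n" by (simp only: of_nat_eq_iff)
    then show False by presburger
  qed
  with assms that show ?thesis by (auto simp: time_set_def time_measure_def)
qed

definition time_average :: "real set \<Rightarrow> real \<Rightarrow> real measure" where
  "time_average T t = density (time_measure T) (\<lambda>s. ennreal (indicator {0..<t} s / t))"

context
  fixes T :: "real set"
  assumes T: "time_set T"
begin

lemma space_time_measure: "space (time_measure T) = T"
  using T by (cases rule: time_setE) (auto simp: space_restrict_space)

lemma id_measurable_time_measure [measurable]: "(\<lambda>s. s) \<in> time_measure T \<rightarrow>\<^sub>M borel"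
  using T by (cases rule: time_setE) (auto intro!: measurable_restrict_space1)

lemma interval_time_measure [measurable]:
  "{a..<b} \<inter> T \<in> sets (time_measure T)" "{a<..<b} \<inter> T \<in> sets (time_measure T)"
  using measurable_sets[OF id_measurable_time_measure, of "{a..<b}"]
    measurable_sets[OF id_measurable_time_measure, of "{a<..<b}"]
  by (simp_all add: vimage_def space_time_measure)

text \<open>The half-open interval is what makes both cases agree: below
  \<open>t \<in> \<nat>\<close> there are exactly \<open>t\<close> naturals, 0 included. This is the
  normalisation behind \<open>time_average\<close>.\<close>

lemma emeasure_time_measure_Ico:
  assumes "t \<in> T"
  shows "emeasure (time_measure T) ({0..<t} \<inter> T) = ennreal t"
  using T
proof (cases rule: time_setE)
  case discrete
  then obtain n where n: "t = real n" using assms by (auto elim: Nats_cases)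
  have "{0..<t} \<inter> \<nat> = real ` {..<n}"
    by (auto simp: n elim!: Nats_cases)
  moreover have "real ` {..<n} \<subseteq> \<nat>" by auto
  ultimately show ?thesis
    unfolding discrete(2) unfolding discrete(1)
    by (simp add: emeasure_count_space_finite card_image n ennreal_of_nat_eq_real_of_nat)
next
  case continuous
  with assms have "{0..<t} \<inter> {0..} = {0..<t}" "0 \<le> t" by auto
  then show ?thesis
    unfolding continuous(2) unfolding continuous(1) by (subst emeasure_restrict_space) auto
qed

text \<open>The bound is free of \<open>s\<close>. Divided by \<open>t\<close>, it controls the
  share of times too close to \<open>s\<close> for the correlation to be small.\<close>

lemma emeasure_time_measure_near:
  assumes "s \<in> T"
  shows "emeasure (time_measure T) ({s - real k<..<s + real k} \<inter> T) \<le> ennreal (2 * real k)"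
  using T
proof (cases rule: time_setE)
  case discrete
  then obtain n where n: "s = real n" using assms by (auto elim: Nats_cases)
  \<comment> \<open>Truncated subtraction in \<open>n - k\<close> only removes negative integers, so
    at most \<open>2 * k\<close> naturals remain.\<close>
  have sub: "{s - real k<..<s + real k} \<inter> \<nat> \<subseteq> real ` {n - k..<n + k}"
  proof
    fix r assume r: "r \<in> {s - real k<..<s + real k} \<inter> \<nat>"
    then obtain m where m: "r = real m" by (auto elim: Nats_cases)
    with r n have "real n - real k < real m" "real m < real n + real k" by auto
    then have "n - k \<le> m" "m < n + k" by linarith+
    with m show "r \<in> real ` {n - k..<n + k}" by auto
  qed
  have fin: "finite ({s - real k<..<s + real k} \<inter> \<nat>)"
    using finite_subset[OF sub] by simp
  have "card ({s - real k<..<s + real k} \<inter> \<nat>) \<le> card (real ` {n - k..<n + k})"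
    using sub by (intro card_mono) auto
  also have "\<dots> \<le> 2 * k" by (simp add: card_image)
  finally have "real (card ({s - real k<..<s + real k} \<inter> \<nat>)) \<le> 2 * real k" by linarith
  with fin show ?thesis
    unfolding discrete(2) unfolding discrete(1)
    by (simp add: emeasure_count_space ennreal_of_nat_eq_real_of_nat ennreal_leI)
next
  case continuous
  then have "emeasure (time_measure T) ({s - real k<..<s + real k} \<inter> T) =
      emeasure lborel ({s - real k<..<s + real k} \<inter> {0..})"
    by (simp add: emeasure_restrict_space)
  also have "\<dots> \<le> emeasure lborel {s - real k<..<s + real k}"
    by (intro emeasure_mono) auto
  also have "\<dots> = ennreal (2 * real k)" by simp
  finally show ?thesis .
qed

lemma sets_time_average [measurable_cong]: "sets (time_average T t) = sets (time_measure T)"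
  and space_time_average: "space (time_average T t) = T"
  by (simp_all add: time_average_def space_time_measure)

lemma emeasure_time_average:
  assumes "0 < t" and A [measurable]: "A \<in> sets (time_measure T)"
  shows "emeasure (time_average T t) A = ennreal (1 / t) * emeasure (time_measure T) ({0..<t} \<inter> A)"
proof -
  have sub: "A \<subseteq> T" using sets.sets_into_space[OF A] by (simp add: space_time_measure)
  then have eq: "({0..<t} \<inter> T) \<inter> A = {0..<t} \<inter> A" by auto
  have [measurable]: "{0..<t} \<inter> A \<in> sets (time_measure T)"
    using sets.Int[OF interval_time_measure(1)[of 0 t] A] by (simp add: eq)
  have "emeasure (time_average T t) A =
      (\<integral>\<^sup>+s. ennreal (indicator {0..<t} s / t) * indicator A s \<partial>time_measure T)"
    unfolding time_average_def by (rule emeasure_density) measurable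
  also have "\<dots> = (\<integral>\<^sup>+s. ennreal (1 / t) * indicator ({0..<t} \<inter> A) s \<partial>time_measure T)"
    by (intro nn_integral_cong) (auto split: split_indicator)
  finally show ?thesis by (simp add: nn_integral_cmult_indicator)
qed

lemma prob_space_time_average:
  assumes "t \<in> T" "0 < t"
  shows "prob_space (time_average T t)"
proof
  have "T \<in> sets (time_measure T)" by (metis sets.top space_time_measure)
  with assms show "emeasure (time_average T t) (space (time_average T t)) = 1"
    by (simp add: space_time_average emeasure_time_average emeasure_time_measure_Ico
        flip: ennreal_mult')
qed

lemma measure_time_average_near:
  assumes "0 < t" "s \<in> T"
  shows "measure (time_average T t) ({s - real k<..<s + real k} \<inter> T) \<le> 2 * real k / t"
proof -
  have "emeasure (time_average T t) ({s - real k<..<s + real k} \<inter> T) \<le>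
      ennreal (1 / t) * emeasure (time_measure T) ({s - real k<..<s + real k} \<inter> T)"
    using assms(1) by (subst emeasure_time_average) (auto intro!: mult_left_mono emeasure_mono)
  also have "\<dots> \<le> ennreal (1 / t) * ennreal (2 * real k)"
    by (intro mult_left_mono emeasure_time_measure_near assms) auto
  also have "\<dots> = ennreal (2 * real k / t)"
    using assms(1) by (simp flip: ennreal_mult)
  finally show ?thesis
    using assms(1) by (auto simp: measure_def intro: enn2real_leI)
qed

text \<open>Translates between the normalised probability measure, on which the estimates are made,
  and the set integrals of the theorem.\<close>

lemma integrable_time_average_iff:
  fixes h :: "real \<Rightarrow> real"
  assumes "0 < t" and [measurable]: "h \<in> borel_measurable (time_measure T)"
  shows "integrable (time_average T t) h \<longleftrightarrow> set_integrable (time_measure T) {0..<t} h"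
proof -
  have "integrable (time_average T t) h \<longleftrightarrow>
      integrable (time_measure T) (\<lambda>s. inverse t * (indicator {0..<t} s * h s))"
    using assms(1) unfolding time_average_def
    by (subst integrable_density) (auto simp: divide_inverse mult_ac)
  with assms(1) show ?thesis by (simp add: set_integrable_def)
qed

lemma integral_time_average:
  fixes h :: "real \<Rightarrow> real"
  assumes "0 < t" and [measurable]: "h \<in> borel_measurable (time_measure T)"
  shows "(\<integral>s. h s \<partial>time_average T t) = 1 / t * (LINT s:{0..<t}|time_measure T. h s)"
proof -
  have "(\<integral>s. h s \<partial>time_average T t) =
      (\<integral>s. inverse t * (indicator {0..<t} s * h s) \<partial>time_measure T)"
    using assms(1) unfolding time_average_def
    by (subst integral_density) (auto simp: divide_inverse mult_ac)
  then show ?thesis by (simp add: set_lebesgue_integral_def divide_inverse)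
qed

end

section \<open>Stationary Markov processes\<close>

context markov_process
begin

lemma zero_in_T: "0 \<in> T"
  using time_set by (auto simp: time_set_def)

lemma diff_in_T: "s \<in> T \<Longrightarrow> r \<in> T \<Longrightarrow> s \<le> r \<Longrightarrow> r - s \<in> T"
  using time_set by (auto simp: time_set_def Nats_diff)

lemma space_P: "space (P x) = space F"
  by (rule sets_eq_imp_space_eq[OF sets_P])

lemma M_measurable [measurable]: "t \<in> T \<Longrightarrow> M t \<in> F \<rightarrow>\<^sub>M borel"
  by (rule measurable_from_subalg[OF subalgebra_Ft adapted])

lemma M_measurable_P: "t \<in> T \<Longrightarrow> M t \<in> P x \<rightarrow>\<^sub>M borel"
  using M_measurable measurable_cong_sets[OF sets_P refl] by blast

lemma P_prob_algebra: "P \<in> borel \<rightarrow>\<^sub>M prob_algebra F"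
proof (rule measurable_prob_algebraI[OF prob_space_P measurable_subprob_algebra])
  fix A assume A: "A \<in> sets F"
  have "emeasure (P x) A = ennreal (measure (P x) A)" for x
  proof -
    interpret prob_space "P x" by (rule prob_space_P)
    show ?thesis by (rule emeasure_eq_measure)
  qed
  with measurable_P[OF A] show "(\<lambda>x. emeasure (P x) A) \<in> borel_measurable borel" by simp
qed (auto simp: sets_P prob_space_P prob_space_imp_subprob_space)

lemma P_subprob [measurable]: "P \<in> borel \<rightarrow>\<^sub>M subprob_algebra F"
  by (rule measurable_prob_algebraD[OF P_prob_algebra])

lemma transition_prob_algebra:
  "t \<in> T \<Longrightarrow> transition P M t \<in> borel \<rightarrow>\<^sub>M prob_algebra borel"
proof -
  assume t: "t \<in> T"
  have "(\<lambda>x. distr (P x) borel (M t)) \<in> borel \<rightarrow>\<^sub>M prob_algebra borel"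
    by (rule measurable_compose[OF P_prob_algebra measurable_distr_prob_space[OF M_measurable[OF t]]])
  then show ?thesis by (simp add: transition_def[abs_def])
qed

lemma transition_subprob [measurable]:
  "t \<in> T \<Longrightarrow> transition P M t \<in> borel \<rightarrow>\<^sub>M subprob_algebra borel"
  by (rule measurable_prob_algebraD[OF transition_prob_algebra])

lemma prob_space_transition: "t \<in> T \<Longrightarrow> prob_space (transition P M t x)"
  unfolding transition_def by (intro prob_space.prob_space_distr prob_space_P M_measurable_P)

lemma sets_transition [simp, measurable_cong]: "sets (transition P M t x) = sets borel"
  by (simp add: transition_def)

lemma space_transition [simp]: "space (transition P M t x) = UNIV"
  by (simp add: transition_def)

text \<open>This is where normality enters: it turns the \<open>s = 0\<close> term of the ergodicity
  hypothesis into the Wasserstein distance at \<open>x\<close> itself.\<close>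

lemma transition_0: "transition P M 0 x = return borel x"
proof -
  interpret prob_space "transition P M 0 x" by (rule prob_space_transition[OF zero_in_T])
  interpret Px: prob_space "P x" by (rule prob_space_P)
  note [measurable] = M_measurable_P[OF zero_in_T, of x]
  have "AE \<omega> in P x. M 0 \<omega> = x"
    using Px.AE_prob_1[OF normal[of x]] by eventually_elim simp
  then have "AE y in transition P M 0 x. y = x"
    unfolding transition_def by (subst AE_distr_iff) auto
  from AE_eq_constD(1)[OF this] have "transition P M 0 x = return (transition P M 0 x) x" .
  also have "\<dots> = return borel x" by (rule return_cong) simp
  finally show ?thesis .
qed

text \<open>Continuous time needs progressive measurability here, on each strip \<open>{0..n} \<times> space F\<close>.\<close>

lemma M_jointly_measurable:
  "(\<lambda>(s, \<omega>). M s \<omega>) \<in> time_measure T \<Otimes>\<^sub>M F \<rightarrow>\<^sub>M borel"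
  using time_set
proof (cases rule: time_setE)
  case discrete
  have "countable (\<nat> :: real set)" unfolding Nats_def by auto
  then show ?thesis
    unfolding discrete(2)
    by (rule measurable_pair_measure_countable1) (use discrete(1) in auto)
next
  case continuous
  define S where "S n = {0..real n} \<times> space F" for n
  let ?N = "time_measure T \<Otimes>\<^sub>M F"
  have sp: "space (time_measure T) = {0..}" by (simp add: continuous(2) space_restrict_space)
  have Sm: "{0..real n} \<in> sets (time_measure T)" for n
    unfolding continuous(2) by (subst sets_restrict_space_iff) auto
  show ?thesis
  proof (rule measurable_piecewise_restrict[of "range S"])
    show "space ?N \<subseteq> \<Union> (range S)"
      using real_arch_simple by (fastforce simp: space_pair_measure sp S_def)
    fix A assume "A \<in> range S"
    then obtain n where A: "A = S n" by auto
    have "S n \<in> sets ?N" unfolding S_def by (intro pair_measureI Sm) auto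
    then show "A \<inter> space ?N \<in> sets ?N" by (simp add: A)
    have sub: "subalgebra F (Ft (real n))" by (rule subalgebra_Ft) (simp add: continuous)
    have "(\<lambda>z. (fst z, snd z)) \<in> restrict_space ?N (S n) \<rightarrow>\<^sub>M
        restrict_space borel {0..real n} \<Otimes>\<^sub>M Ft (real n)"
    proof (rule measurable_Pair)
      show "(\<lambda>z. fst z) \<in> restrict_space ?N (S n) \<rightarrow>\<^sub>M restrict_space borel {0..real n}"
        using time_set
        by (intro measurable_restrict_space2 measurable_restrict_space1
            measurable_compose[OF measurable_fst id_measurable_time_measure])
           (auto simp: space_restrict_space S_def)
      show "(\<lambda>z. snd z) \<in> restrict_space ?N (S n) \<rightarrow>\<^sub>M Ft (real n)"
        by (intro measurable_restrict_space1 measurable_compose[OF measurable_snd]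
            measurable_from_subalg[OF sub] measurable_ident_sets[OF refl])
    qed
    from measurable_compose[OF this progressive[OF continuous(1), of "real n"]]
    show "(\<lambda>(s, \<omega>). M s \<omega>) \<in> restrict_space ?N A \<rightarrow>\<^sub>M borel"
      by (simp add: A case_prod_beta')
  qed auto
qed

end

text \<open>Filling in the limit value off \<open>T\<close> turns convergence along \<open>T\<close>
  into convergence along \<open>at_top\<close>, the form taken by dominated convergence with a real
  parameter.\<close>

lemma tendsto_time_at_top_iff:
  "(h \<longlongrightarrow> l) (time_at_top T) \<longleftrightarrow> ((\<lambda>t. if t \<in> T then h t else l) \<longlongrightarrow> l) at_top"
  for h :: "real \<Rightarrow> 'b::metric_space"
  unfolding tendsto_iff time_at_top_def eventually_inf_principal
  by (intro all_cong imp_cong refl eventually_subst always_eventually) auto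

lemma eventually_time_at_top:
  "eventually (\<lambda>t. t \<in> T \<and> c < t) (time_at_top T)"
  unfolding time_at_top_def eventually_inf_principal
  using eventually_gt_at_top[of c] by eventually_elim simp

section \<open>The process started from its invariant measure\<close>

locale stationary_markov_process = markov_process T F P Ft \<theta> M + \<pi>: prob_space \<pi>
  for T F and P :: "'a :: polish_space \<Rightarrow> 'w measure" and Ft \<theta> M and \<pi> :: "'a measure" +
  assumes sets_pi [measurable_cong]: "sets \<pi> = sets borel"
    and invariant: "invariant_measure T P M \<pi>"
begin

definition P\<pi> :: "'w measure" where
  "P\<pi> = \<pi> \<bind> P"

lemma space_pi: "space \<pi> = UNIV"
  using sets_eq_imp_space_eq[OF sets_pi] by simp

lemma measurable_pi_iff: "u \<in> \<pi> \<rightarrow>\<^sub>M N \<longleftrightarrow> u \<in> borel \<rightarrow>\<^sub>M N"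
  by (simp only: measurable_cong_sets[OF sets_pi refl])

lemma P_subprob_pi [measurable]: "P \<in> \<pi> \<rightarrow>\<^sub>M subprob_algebra F"
  using P_subprob by (simp add: measurable_pi_iff)

lemma sets_P\<pi> [measurable_cong]: "sets P\<pi> = sets F"
  unfolding P\<pi>_def by (rule sets_bind_measurable[OF P_subprob_pi]) (simp add: space_pi)

lemma space_P\<pi>: "space P\<pi> = space F"
  by (rule sets_eq_imp_space_eq[OF sets_P\<pi>])

sublocale P\<pi>: prob_space P\<pi>
  unfolding P\<pi>_def by (rule \<pi>.prob_space_bind[OF _ P_subprob_pi]) (simp add: prob_space_P)

lemma distr_M:
  assumes t: "t \<in> T"
  shows "distr P\<pi> borel (M t) = \<pi>"
proof (rule measure_eqI)
  fix B assume B: "B \<in> sets (distr P\<pi> borel (M t))"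
  have "distr P\<pi> borel (M t) = \<pi> \<bind> transition P M t"
    unfolding P\<pi>_def using distr_bind[OF P_subprob_pi _ M_measurable[OF t]]
    by (simp add: space_pi transition_def[abs_def])
  moreover have "transition P M t \<in> \<pi> \<rightarrow>\<^sub>M subprob_algebra borel"
    using transition_subprob[OF t] by (simp add: measurable_pi_iff)
  ultimately have "emeasure (distr P\<pi> borel (M t)) B = (\<integral>\<^sup>+x. emeasure (transition P M t x) B \<partial>\<pi>)"
    using B by (simp add: emeasure_bind[where N = borel] space_pi)
  with B t show "emeasure (distr P\<pi> borel (M t)) B = emeasure \<pi> B"
    using invariant by (simp add: invariant_measure_def)
qed (simp add: sets_pi)

text \<open>The Markov property, given through conditional expectations, is integrated over the
  event \<open>M s \<in> A\<close>, which belongs to the past at time \<open>s\<close>.\<close>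

lemma markov_rectangle:
  assumes s: "s \<in> T" and t: "t \<in> T" and A [measurable]: "A \<in> sets borel" and B [measurable]: "B \<in> sets borel"
  shows "emeasure (P x) {\<omega> \<in> space F. M s \<omega> \<in> A \<and> M (s + t) \<omega> \<in> B} =
    (\<integral>\<^sup>+\<omega>. indicator A (M s \<omega>) * emeasure (transition P M t (M s \<omega>)) B \<partial>P x)"
proof -
  interpret Px: prob_space "P x" by (rule prob_space_P)
  have st: "s + t \<in> T" using s t time_set by (auto simp: time_set_def)
  note [measurable] = M_measurable_P[OF s, of x] M_measurable_P[OF st, of x]
  have "subalgebra (P x) (Ft s)"
    using subalgebra_Ft[OF s] by (simp add: subalgebra_def sets_P space_P)
  then interpret finite_measure_subalgebra "P x" "Ft s"
    by unfold_locales
  define E where "E = {\<omega> \<in> space F. M s \<omega> \<in> A}"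
  define H where "H = {\<omega> \<in> space F. M (s + t) \<omega> \<in> B}"
  define k where "k \<omega> = measure (transition P M t (M s \<omega>)) B" for \<omega>
  have EFt: "E \<in> sets (Ft s)"
    using measurable_sets[OF adapted[OF s] A] subalgebra_Ft[OF s]
    by (simp add: E_def subalgebra_def vimage_def Int_def conj_commute)
  have EH [measurable]: "E \<in> sets (P x)" "H \<in> sets (P x)"
    unfolding E_def H_def space_P[of x, symmetric] by measurable
  have [measurable]: "(\<lambda>y. measure (transition P M t y) B) \<in> borel_measurable borel"
    unfolding measure_def
    by (intro borel_measurable_enn2real measurable_emeasure_kernel[OF transition_subprob[OF t] B])
  have [measurable]: "k \<in> borel_measurable (P x)"
    unfolding k_def by measurable
  have k01: "0 \<le> k \<omega>" "k \<omega> \<le> 1" for \<omega>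
  proof -
    interpret K: prob_space "transition P M t (M s \<omega>)" by (rule prob_space_transition[OF t])
    show "0 \<le> k \<omega>" "k \<omega> \<le> 1" by (simp_all add: k_def)
  qed
  have ik: "integrable (P x) (\<lambda>\<omega>. indicator E \<omega> * k \<omega>)"
    using k01 by (intro Px.integrable_bounded[of _ 1]) (auto split: split_indicator)
  have "measure (P x) (E \<inter> H) = (\<integral>\<omega>. indicator E \<omega> * indicator H \<omega> \<partial>P x)"
    by (simp add: indicator_inter_arith[symmetric])
  \<comment> \<open>The defining property of conditional expectation, applicable because
    \<open>E\<close> lies in \<open>Ft s\<close>.\<close>
  also have "\<dots> = (\<integral>\<omega>. indicator E \<omega> * real_cond_exp (P x) (Ft s) (indicator H) \<omega> \<partial>P x)"
    using real_cond_exp_intA[OF _ EFt, of "indicator H"]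
    by (simp add: set_lebesgue_integral_def less_top[symmetric])
  also have "\<dots> = (\<integral>\<omega>. indicator E \<omega> * k \<omega> \<partial>P x)"
    using markov[OF t s B, of x] by (intro integral_cong_AE) (auto simp: H_def k_def elim!: eventually_mono)
  finally have "ennreal (measure (P x) (E \<inter> H)) = (\<integral>\<^sup>+\<omega>. indicator E \<omega> * k \<omega> \<partial>P x)"
    using nn_integral_eq_integral[OF ik] k01 by (simp)
  also have "\<dots> = (\<integral>\<^sup>+\<omega>. indicator A (M s \<omega>) * emeasure (transition P M t (M s \<omega>)) B \<partial>P x)"
  proof (rule nn_integral_cong)
    fix \<omega> assume "\<omega> \<in> space (P x)"
    interpret K: prob_space "transition P M t (M s \<omega>)" by (rule prob_space_transition[OF t])
    show "ennreal (indicator E \<omega> * k \<omega>) = indicator A (M s \<omega>) * emeasure (transition P M t (M s \<omega>)) B"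
      using \<open>\<omega> \<in> space (P x)\<close>
      by (auto simp: E_def k_def space_P K.emeasure_eq_measure split: split_indicator)
  qed
  also have "ennreal (measure (P x) (E \<inter> H)) = emeasure (P x) {\<omega> \<in> space F. M s \<omega> \<in> A \<and> M (s + t) \<omega> \<in> B}"
    unfolding Px.emeasure_eq_measure by (auto simp: E_def H_def intro!: arg_cong[where f = "measure (P x)"])
  finally show ?thesis .
qed

text \<open>Rectangles form an intersection-stable generator. On them the Markov property produces
  an integral against the law of \<open>M s\<close>, which is \<open>\<pi>\<close> whatever
  \<open>s\<close> is. Hence the right-hand side depends only on the lag \<open>t\<close>.\<close>

lemma joint_law:
  assumes s: "s \<in> T" and t: "t \<in> T"
  shows "distr P\<pi> (borel \<Otimes>\<^sub>M borel) (\<lambda>\<omega>. (M s \<omega>, M (s + t) \<omega>)) =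
    \<pi> \<bind> (\<lambda>y. distr (transition P M t y) (borel \<Otimes>\<^sub>M borel) (Pair y))" (is "?J = \<pi> \<bind> ?k")
proof -
  have st: "s + t \<in> T" using s t time_set by (auto simp: time_set_def)
  note [measurable] = M_measurable[OF s] M_measurable[OF st]
  have k: "?k \<in> borel \<rightarrow>\<^sub>M subprob_algebra (borel \<Otimes>\<^sub>M borel)"
    by (rule measurable_distr2[OF _ transition_subprob[OF t]]) simp
  then have k': "?k \<in> \<pi> \<rightarrow>\<^sub>M subprob_algebra (borel \<Otimes>\<^sub>M borel)"
    by (simp add: measurable_pi_iff)
  let ?E = "{a \<times> b | a b. a \<in> sets (borel :: 'a measure) \<and> b \<in> sets (borel :: 'a measure)}"
  have sb: "sets (\<pi> \<bind> ?k) = sets (borel \<Otimes>\<^sub>M borel)"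
    by (rule sets_bind_measurable[OF k']) (simp add: space_pi)
  show ?thesis
  proof (rule measure_eqI_generator_eq[OF Int_stable_pair_measure_generator[of borel borel],
        where \<Omega> = UNIV and A = "\<lambda>_. UNIV"])
    fix X assume "X \<in> ?E"
    then obtain A B where X: "X = A \<times> B" and [measurable]: "A \<in> sets borel" "B \<in> sets borel" by auto
    note [measurable] = measurable_emeasure_kernel[OF transition_subprob[OF t] \<open>B \<in> sets borel\<close>]
    have "emeasure ?J X = emeasure P\<pi> {\<omega> \<in> space F. M s \<omega> \<in> A \<and> M (s + t) \<omega> \<in> B}"
      by (subst emeasure_distr) (auto simp: X space_P\<pi> intro!: arg_cong[where f = "emeasure P\<pi>"])
    also have "\<dots> = (\<integral>\<^sup>+x. emeasure (P x) {\<omega> \<in> space F. M s \<omega> \<in> A \<and> M (s + t) \<omega> \<in> B} \<partial>\<pi>)"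
      unfolding P\<pi>_def by (rule emeasure_bind[OF _ P_subprob_pi]) (auto simp: space_pi)
    also have "\<dots> = (\<integral>\<^sup>+x. \<integral>\<^sup>+\<omega>. indicator A (M s \<omega>) * emeasure (transition P M t (M s \<omega>)) B \<partial>P x \<partial>\<pi>)"
      using markov_rectangle[OF s t] by simp
    also have "\<dots> = (\<integral>\<^sup>+\<omega>. indicator A (M s \<omega>) * emeasure (transition P M t (M s \<omega>)) B \<partial>P\<pi>)"
      unfolding P\<pi>_def by (rule nn_integral_bind[OF _ P_subprob_pi, symmetric]) measurable
    also have "\<dots> = (\<integral>\<^sup>+y. indicator A y * emeasure (transition P M t y) B \<partial>distr P\<pi> borel (M s))"
      by (rule nn_integral_distr[symmetric]) measurable
    also have "\<dots> = (\<integral>\<^sup>+y. emeasure (?k y) X \<partial>\<pi>)"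
      unfolding distr_M[OF s]
    proof (rule nn_integral_cong)
      fix y
      have "Pair y -` X = (if y \<in> A then B else {})" by (auto simp: X)
      then show "indicator A y * emeasure (transition P M t y) B = emeasure (?k y) X"
        by (subst emeasure_distr) (auto simp: X)
    qed
    also have "\<dots> = emeasure (\<pi> \<bind> ?k) X"
      by (rule emeasure_bind[OF _ k', symmetric]) (auto simp: space_pi X)
    finally show "emeasure ?J X = emeasure (\<pi> \<bind> ?k) X" .
  next
    show "sets ?J = sigma_sets UNIV ?E" "sets (\<pi> \<bind> ?k) = sigma_sets UNIV ?E"
      unfolding sb by (simp_all add: sets_pair_measure)
    show "range (\<lambda>_. UNIV) \<subseteq> ?E" by (auto intro!: exI[of _ UNIV])
    interpret J: prob_space ?J by (rule P\<pi>.prob_space_distr) measurable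
    show "emeasure ?J UNIV \<noteq> \<infinity>" by (simp add: J.emeasure_eq_measure)
  qed auto
qed

lemma correlation_eq:
  fixes u v :: "'a \<Rightarrow> real"
  assumes s: "s \<in> T" and t: "t \<in> T"
    and [measurable]: "u \<in> borel_measurable borel" "v \<in> borel_measurable borel"
    and b: "\<And>x. \<bar>u x\<bar> \<le> K" "\<And>x. \<bar>v x\<bar> \<le> K"
  shows "(\<integral>\<omega>. u (M s \<omega>) * v (M (s + t) \<omega>) \<partial>P\<pi>) = (\<integral>y. u y * (\<integral>z. v z \<partial>transition P M t y) \<partial>\<pi>)"
proof -
  have st: "s + t \<in> T" using s t time_set by (auto simp: time_set_def)
  note [measurable] = M_measurable[OF s] M_measurable[OF st]
  let ?k = "\<lambda>y. distr (transition P M t y) (borel \<Otimes>\<^sub>M borel) (Pair y)"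
  have "?k \<in> borel \<rightarrow>\<^sub>M subprob_algebra (borel \<Otimes>\<^sub>M borel)"
    by (rule measurable_distr2[OF _ transition_subprob[OF t]]) simp
  then have k: "?k \<in> \<pi> \<rightarrow>\<^sub>M subprob_algebra (borel \<Otimes>\<^sub>M borel)"
    by (simp add: measurable_pi_iff)
  have "(\<integral>\<omega>. u (M s \<omega>) * v (M (s + t) \<omega>) \<partial>P\<pi>) =
      (\<integral>z. u (fst z) * v (snd z) \<partial>distr P\<pi> (borel \<Otimes>\<^sub>M borel) (\<lambda>\<omega>. (M s \<omega>, M (s + t) \<omega>)))"
    by (subst integral_distr) auto
  also have "\<dots> = (\<integral>y. \<integral>z. u (fst z) * v (snd z) \<partial>?k y \<partial>\<pi>)"
    unfolding joint_law[OF s t]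
  proof (rule integral_bind[OF _ _ k, where B = "K * K" and B' = 1])
    show "finite_measure \<pi>" by (rule \<pi>.finite_measure_axioms)
    show "\<bar>u (fst z) * v (snd z)\<bar> \<le> K * K" for z
      using b(1)[of "fst z"] b(2)[of "snd z"] by (auto simp: abs_mult intro!: mult_mono)
    have "prob_space (?k y)" for y
      by (rule prob_space.prob_space_distr[OF prob_space_transition[OF t]]) simp
    then show "AE y in \<pi>. emeasure (?k y) (space (?k y)) \<le> ennreal 1"
      by (simp add: prob_space.emeasure_space_1 del: space_distr)
  qed measurable
  also have "\<dots> = (\<integral>y. u y * (\<integral>z. v z \<partial>transition P M t y) \<partial>\<pi>)"
    by (subst integral_distr) auto
  finally show ?thesis .
qed

end

section \<open>Decay of correlations and convergence of averages\<close>

context stationary_markov_process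
begin

lemma integral_transition_tendsto:
  fixes g :: "'a \<Rightarrow> real"
  assumes diam: "\<And>x y :: 'a. dist x y \<le> 1"
    and ergodic: "((\<lambda>t. SUP s\<in>T. \<integral>y. wasserstein (transition P M t y) \<pi> \<partial>(transition P M s x))
                    \<longlongrightarrow> 0) (time_at_top T)"
    and g: "bounded_lipschitz g"
  shows "((\<lambda>t. \<integral>z. g z \<partial>transition P M t x) \<longlongrightarrow> (\<integral>z. g z \<partial>\<pi>)) (time_at_top T)"
proof -
  define W where "W t y = wasserstein (transition P M t y) \<pi>" for t y
  have W01: "0 \<le> W t y" "W t y \<le> 1" if "t \<in> T" for t y
    unfolding W_def
    using wasserstein_nonneg[OF diam prob_space_transition[OF that] sets_transition \<pi>.prob_space_axioms sets_pi]
      wasserstein_le_1[OF diam prob_space_transition[OF that] sets_transition \<pi>.prob_space_axioms sets_pi]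
    by auto
  have Wm: "W t \<in> borel_measurable borel" if "t \<in> T" for t
    using wasserstein_measurable[OF diam transition_prob_algebra[OF that] \<pi>.prob_space_axioms sets_pi]
    by (simp add: W_def[abs_def])
  have W_le: "W t x \<le> (SUP s\<in>T. \<integral>y. W t y \<partial>transition P M s x)" if t: "t \<in> T" for t
  proof -
    note [measurable] = Wm[OF t]
    \<comment> \<open>Evaluating the integral at the point mass uses the measurability of
      \<open>W t\<close>.\<close>
    have "W t x = (\<integral>y. W t y \<partial>transition P M 0 x)"
      by (simp add: transition_0 integral_return)
    also have "\<dots> \<le> (SUP s\<in>T. \<integral>y. W t y \<partial>transition P M s x)"
    \<comment> \<open>A real supremum dominates its members only over a set bounded above; the bound
      1 comes from \<open>W01\<close>.\<close>
    proof (rule cSUP_upper[OF zero_in_T bdd_aboveI2[where M = 1]])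
      fix s assume s: "s \<in> T"
      interpret K: prob_space "transition P M s x" by (rule prob_space_transition[OF s])
      have "integrable (transition P M s x) (W t)"
        using W01[OF t] by (intro K.integrable_bounded[of _ 1]) auto
      then have "(\<integral>y. W t y \<partial>transition P M s x) \<le> (\<integral>y. 1 \<partial>transition P M s x)"
        using W01[OF t] by (intro integral_mono) auto
      then show "(\<integral>y. W t y \<partial>transition P M s x) \<le> 1" by (simp only: K.prob_space lebesgue_integral_const) simp
    qed
    finally show ?thesis .
  qed
  obtain L where L: "L-lipschitz_on UNIV g" using g by (auto simp: bounded_lipschitz_def)
  have "((\<lambda>t. (L + 1) * (SUP s\<in>T. \<integral>y. W t y \<partial>transition P M s x)) \<longlongrightarrow> 0) (time_at_top T)"
    using tendsto_mult[OF tendsto_const ergodic, of "L + 1"] by (simp add: W_def)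
  then have "((\<lambda>t. (\<integral>z. g z \<partial>transition P M t x) - (\<integral>z. g z \<partial>\<pi>)) \<longlongrightarrow> 0) (time_at_top T)"
  proof (rule Lim_null_comparison[rotated])
    show "\<forall>\<^sub>F t in time_at_top T. norm ((\<integral>z. g z \<partial>transition P M t x) - (\<integral>z. g z \<partial>\<pi>))
        \<le> (L + 1) * (SUP s\<in>T. \<integral>y. W t y \<partial>transition P M s x)"
      using eventually_time_at_top[of T 0]
    proof eventually_elim
      case (elim t)
      then have t: "t \<in> T" by simp
      have "\<bar>(\<integral>z. g z \<partial>transition P M t x) - (\<integral>z. g z \<partial>\<pi>)\<bar> \<le> (L + 1) * W t x"
        unfolding W_def
        by (rule lipschitz_integral_diff_le[OF diam L prob_space_transition[OF t] sets_transition
              \<pi>.prob_space_axioms sets_pi])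
      also have "\<dots> \<le> (L + 1) * (SUP s\<in>T. \<integral>y. W t y \<partial>transition P M s x)"
        using W_le[OF t] lipschitz_on_nonneg[OF L] by (intro mult_left_mono) auto
      finally show ?case by simp
    qed
  qed
  then show ?thesis by (rule LIM_zero_cancel)
qed

text \<open>Conditioning on the earlier time turns the correlation into the integral of
  \<open>g y * G t y\<close> against \<open>\<pi>\<close>, with \<open>t\<close> the lag. This is at
  most \<open>K\<close> times the \<open>L^1\<close> norm of \<open>G t\<close>, which tends to 0 by
  dominated convergence, so one \<open>k\<close> serves all pairs of times.\<close>

lemma correlation_decay:
  fixes g :: "'a \<Rightarrow> real"
  assumes [measurable]: "g \<in> borel_measurable borel" and b: "\<And>x. \<bar>g x\<bar> \<le> K"
    and lim: "\<And>x. ((\<lambda>t. \<integral>z. g z \<partial>transition P M t x) \<longlongrightarrow> 0) (time_at_top T)"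
    and "0 < \<delta>"
  obtains k :: nat where
    "\<And>s r. s \<in> T \<Longrightarrow> r \<in> T \<Longrightarrow> real k \<le> \<bar>s - r\<bar> \<Longrightarrow> \<bar>\<integral>\<omega>. g (M s \<omega>) * g (M r \<omega>) \<partial>P\<pi>\<bar> \<le> \<delta>"
proof -
  define G where "G t x = (if t \<in> T then \<integral>z. g z \<partial>transition P M t x else 0)" for t x
  have K0: "0 \<le> K" using b by (meson abs_ge_zero order_trans)
  have Gm: "G t \<in> borel_measurable borel" for t
  proof (cases "t \<in> T")
    case True
    show ?thesis
      using measurable_compose[OF transition_subprob[OF True] integral_measurable_subprob_algebra[of g borel]]
      by (simp add: G_def[abs_def] True)
  qed (simp add: G_def[abs_def])
  note [measurable] = Gm
  have GK: "\<bar>G t x\<bar> \<le> K" for t x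
  proof (cases "t \<in> T")
    case t: True
    interpret prob_space "transition P M t x" by (rule prob_space_transition[OF t])
    have "\<bar>G t x\<bar> \<le> (\<integral>z. \<bar>g z\<bar> \<partial>transition P M t x)"
      using t by (simp add: G_def integral_abs_bound)
    also have "\<dots> \<le> (\<integral>z. K \<partial>transition P M t x)"
      using b integrable_bounded[of g K] by (intro integral_mono) auto
    also have "\<dots> = K" using prob_space by simp
    finally show ?thesis .
  qed (simp add: G_def K0)
  have "((\<lambda>t. \<integral>x. \<bar>G t x\<bar> \<partial>\<pi>) \<longlongrightarrow> (\<integral>x. 0 \<partial>\<pi>)) at_top"
  proof (rule integral_dominated_convergence_at_top[where w = "\<lambda>_. K"])
    show "AE x in \<pi>. ((\<lambda>t. \<bar>G t x\<bar>) \<longlongrightarrow> 0) at_top"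
      using lim unfolding tendsto_time_at_top_iff by (intro AE_I2 tendsto_rabs_zero) (simp add: G_def)
  qed (use GK in auto)
  \<comment> \<open>\<open>K + 1\<close> in place of \<open>K\<close> keeps the quotient meaningful
    when \<open>K = 0\<close>.\<close>
  moreover have "0 < \<delta> / (K + 1)" using \<open>0 < \<delta>\<close> K0 by simp
  ultimately have "\<forall>\<^sub>F t in at_top. (\<integral>x. \<bar>G t x\<bar> \<partial>\<pi>) < \<delta> / (K + 1)"
    by (intro order_tendstoD(2)) auto
  then obtain N where N: "\<And>t. N \<le> t \<Longrightarrow> (\<integral>x. \<bar>G t x\<bar> \<partial>\<pi>) < \<delta> / (K + 1)"
    by (auto simp: eventually_at_top_linorder)
  obtain k :: nat where k: "N \<le> real k" using real_arch_simple by blast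
  have *: "\<bar>\<integral>\<omega>. g (M s \<omega>) * g (M r \<omega>) \<partial>P\<pi>\<bar> \<le> \<delta>"
    if s: "s \<in> T" and r: "r \<in> T" and sr: "s \<le> r" and far: "real k \<le> r - s" for s r
  proof -
    have t: "r - s \<in> T" by (rule diff_in_T[OF s r sr])
    have Gi: "integrable \<pi> (G (r - s))" using GK by (intro \<pi>.integrable_bounded[of _ K]) auto
    have gGi: "integrable \<pi> (\<lambda>y. g y * G (r - s) y)"
      using GK b K0 by (intro \<pi>.integrable_bounded[of _ "K * K"]) (auto simp: abs_mult intro!: mult_mono)
    have "(\<integral>\<omega>. g (M s \<omega>) * g (M r \<omega>) \<partial>P\<pi>) = (\<integral>y. g y * G (r - s) y \<partial>\<pi>)"
      using correlation_eq[OF s t, of g g K] b t by (simp add: G_def)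
    also have "\<bar>\<dots>\<bar> \<le> (\<integral>y. \<bar>g y * G (r - s) y\<bar> \<partial>\<pi>)"
      by (rule integral_abs_bound)
    also have "\<dots> \<le> (\<integral>y. K * \<bar>G (r - s) y\<bar> \<partial>\<pi>)"
    proof (rule integral_mono)
      show "\<bar>g y * G (r - s) y\<bar> \<le> K * \<bar>G (r - s) y\<bar>" for y
        using b[of y] by (simp add: abs_mult mult_right_mono)
    qed (use Gi integrable_abs[OF gGi] in simp_all)
    also have "\<dots> = K * (\<integral>y. \<bar>G (r - s) y\<bar> \<partial>\<pi>)" by simp
    also have "\<dots> \<le> (K + 1) * (\<delta> / (K + 1))"
      using N[of "r - s"] k far K0 by (intro mult_mono) auto
    also have "\<dots> = \<delta>" using K0 by simp
    finally show ?thesis .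
  qed
  \<comment> \<open>The product is symmetric in the two times, so the ordered case is used with
    either one first.\<close>
  show ?thesis
  proof (rule that[of k])
    fix s r assume "s \<in> T" "r \<in> T" "real k \<le> \<bar>s - r\<bar>"
    then show "\<bar>\<integral>\<omega>. g (M s \<omega>) * g (M r \<omega>) \<partial>P\<pi>\<bar> \<le> \<delta>"
      using *[of s r] *[of r s] by (cases "s \<le> r") (auto simp: mult.commute)
  qed
qed

lemma stationary_average:
  assumes "t \<in> T" "0 < t"
  shows "stationary_average (time_average T t) P\<pi> \<pi> M"
proof -
  interpret U: prob_space "time_average T t" by (rule prob_space_time_average[OF time_set assms])
  show ?thesis
  proof
    have "sets (time_average T t \<Otimes>\<^sub>M P\<pi>) = sets (time_measure T \<Otimes>\<^sub>M F)"
      by (intro sets_pair_measure_cong sets_time_average[OF time_set] sets_P\<pi>)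
    then show "case_prod M \<in> time_average T t \<Otimes>\<^sub>M P\<pi> \<rightarrow>\<^sub>M \<pi>"
      using M_jointly_measurable measurable_cong_sets[OF _ sets_pi] by blast
    show "distr P\<pi> \<pi> (M s) = \<pi>" if "s \<in> space (time_average T t)" for s
      using distr_M[of s] that distr_cong[OF refl sets_pi, of P\<pi> "M s" "M s"]
      by (simp add: space_time_average[OF time_set])
  qed
qed

lemma second_moment_average_tendsto:
  fixes g :: "'a \<Rightarrow> real"
  assumes g [measurable]: "g \<in> borel_measurable borel" and b: "\<And>x. \<bar>g x\<bar> \<le> K"
    and lim: "\<And>x. ((\<lambda>t. \<integral>z. g z \<partial>transition P M t x) \<longlongrightarrow> 0) (time_at_top T)"
  shows "((\<lambda>t. \<integral>\<omega>. (\<integral>s. g (M s \<omega>) \<partial>time_average T t)\<^sup>2 \<partial>P\<pi>) \<longlongrightarrow> 0) (time_at_top T)"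
proof (rule tendstoI)
  fix e :: real assume "0 < e"
  then have "0 < e / 2" by simp
  from correlation_decay[OF g b lim this] obtain k :: nat where
    k: "\<And>s r. s \<in> T \<Longrightarrow> r \<in> T \<Longrightarrow> real k \<le> \<bar>s - r\<bar> \<Longrightarrow> \<bar>\<integral>\<omega>. g (M s \<omega>) * g (M r \<omega>) \<partial>P\<pi>\<bar> \<le> e / 2"
    by blast
  \<comment> \<open>For \<open>t > c\<close> the window of radius \<open>k\<close> contributes less
    than \<open>e / 2\<close>; the maximum with 0 also makes \<open>t\<close> positive.\<close>
  define c where "c = max 0 (K\<^sup>2 * (2 * real k) / (e / 2))"
  show "\<forall>\<^sub>F t in time_at_top T. dist (\<integral>\<omega>. (\<integral>s. g (M s \<omega>) \<partial>time_average T t)\<^sup>2 \<partial>P\<pi>) 0 < e"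
    using eventually_time_at_top[of T c]
  proof eventually_elim
    case (elim t)
    then have t: "t \<in> T" "0 < t" and ct: "K\<^sup>2 * (2 * real k) / (e / 2) < t" by (auto simp: c_def)
    interpret stationary_average "time_average T t" P\<pi> \<pi> M by (rule stationary_average[OF t])
    have "g \<in> borel_measurable \<pi>" using g by (simp add: measurable_pi_iff)
    from measurable_compose[OF m this]
    have gM: "(\<lambda>(s, \<omega>). g (M s \<omega>)) \<in> borel_measurable (time_average T t \<Otimes>\<^sub>M P\<pi>)"
      by (simp add: case_prod_beta')
    have spU: "space (time_average T t) = T" by (rule space_time_average[OF time_set])
    have "(\<integral>\<omega>. (\<integral>s. g (M s \<omega>) \<partial>time_average T t)\<^sup>2 \<partial>P\<pi>) \<le> e / 2 + K\<^sup>2 * (2 * real k / t)"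
    \<comment> \<open>Off the window the lag is at least \<open>k\<close>, where
      \<open>correlation_decay\<close> applies. The window has mass at most
      \<open>2 * real k / t\<close> under the uniform law.\<close>
    proof (rule average_second_moment_le[where N = "\<lambda>s. {s - real k<..<s + real k} \<inter> T"])
      show "{s - real k<..<s + real k} \<inter> T \<in> sets (time_average T t)" for s
        using interval_time_measure(2)[OF time_set] sets_time_average[OF time_set] by blast
      show "measure (time_average T t) ({s - real k<..<s + real k} \<inter> T) \<le> 2 * real k / t"
        if "s \<in> space (time_average T t)" for s
        using measure_time_average_near[OF time_set t(2)] that spU by auto
      show "\<bar>\<integral>\<omega>. g (M s \<omega>) * g (M r \<omega>) \<partial>P\<pi>\<bar> \<le> e / 2"
        if "s \<in> space (time_average T t)" "r \<in> space (time_average T t)"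
          "r \<notin> {s - real k<..<s + real k} \<inter> T" for s r
        using that spU by (intro k) auto
    qed (use b \<open>0 < e\<close> in \<open>auto intro: U.prob_space_axioms P\<pi>.prob_space_axioms gM\<close>)
    also have "\<dots> < e / 2 + e / 2"
      using ct t(2) \<open>0 < e\<close> by (simp add: field_simps)
    finally show ?case by (simp)
  qed
qed

text \<open>With \<open>h = f - g\<close> and \<open>g\<close> bounded Lipschitz, the deviation of
  \<open>f\<close> is the average of \<open>h\<close>, minus the mean of \<open>h\<close>, plus the
  deviation of \<open>g\<close>. The first two are small uniformly in \<open>t\<close> by Jensen's
  inequality, the last for large \<open>t\<close>.\<close>

lemma moment_average_tendsto:
  fixes f :: "'a \<Rightarrow> real"
  assumes p: "1 \<le> p" and f: "f \<in> Lp p \<pi>"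
    and lim: "\<And>g x. bounded_lipschitz (g :: 'a \<Rightarrow> real) \<Longrightarrow>
      ((\<lambda>t. \<integral>z. g z \<partial>transition P M t x) \<longlongrightarrow> (\<integral>z. g z \<partial>\<pi>)) (time_at_top T)"
  shows "((\<lambda>t. \<integral>\<omega>. \<bar>(\<integral>s. f (M s \<omega>) \<partial>time_average T t) - (\<integral>x. f x \<partial>\<pi>)\<bar> powr p \<partial>P\<pi>) \<longlongrightarrow> 0)
    (time_at_top T)"
proof -
  define D where "D f t \<omega> = (\<integral>s. f (M s \<omega>) \<partial>time_average T t) - (\<integral>x. f x \<partial>\<pi>)" for f :: "'a \<Rightarrow> real" and t \<omega>
  have D_lip: "((\<lambda>t. \<integral>\<omega>. \<bar>D g t \<omega>\<bar> powr p \<partial>P\<pi>) \<longlongrightarrow> 0) (time_at_top T)"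
    if g: "bounded_lipschitz g" for g :: "'a \<Rightarrow> real"
  proof -
    note [measurable] = bounded_lipschitz_measurable[OF g]
    obtain K where K: "\<And>x. \<bar>g x\<bar> \<le> K" using g by (auto simp: bounded_lipschitz_def)
    \<comment> \<open>Centring makes the limit zero, as the second moment estimate requires.\<close>
    define g0 where "g0 x = g x - (\<integral>x. g x \<partial>\<pi>)" for x
    define K0 where "K0 = K + \<bar>\<integral>x. g x \<partial>\<pi>\<bar>"
    have g0m [measurable]: "g0 \<in> borel_measurable borel" unfolding g0_def by measurable
    have g0K: "\<bar>g0 x\<bar> \<le> K0" for x using K[of x] by (auto simp: g0_def K0_def)
    have K0: "0 \<le> K0" using g0K by (meson abs_ge_zero order_trans)
    have lim0: "((\<lambda>t. \<integral>z. g0 z \<partial>transition P M t x) \<longlongrightarrow> 0) (time_at_top T)" for x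
    proof -
      have "\<forall>\<^sub>F t in time_at_top T. (\<integral>z. g z \<partial>transition P M t x) - (\<integral>x. g x \<partial>\<pi>) = (\<integral>z. g0 z \<partial>transition P M t x)"
        using eventually_time_at_top[of T 0]
      proof eventually_elim
        case (elim t)
        then interpret prob_space "transition P M t x" by (intro prob_space_transition) simp
        have "integrable (transition P M t x) g" using K by (intro integrable_bounded[of _ K]) auto
        then show ?case using prob_space by (simp add: g0_def)
      qed
      from Lim_transform_eventually[OF tendsto_diff[OF lim[OF g] tendsto_const] this]
      show ?thesis by simp
    qed
    have D_eq: "D g t \<omega> = (\<integral>s. g0 (M s \<omega>) \<partial>time_average T t)"
      and D_le: "\<bar>D g t \<omega>\<bar> \<le> K0" and D_meas: "D g t \<in> borel_measurable P\<pi>"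
      if t: "t \<in> T" "0 < t" and w: "\<omega> \<in> space P\<pi>" for t \<omega>
    proof -
      interpret stationary_average "time_average T t" P\<pi> \<pi> M by (rule stationary_average[OF t])
      have "(\<lambda>s. M s \<omega>) \<in> time_average T t \<rightarrow>\<^sub>M \<pi>" using measurable_Pair1[OF m w] by simp
      then have [measurable]: "(\<lambda>s. M s \<omega>) \<in> time_average T t \<rightarrow>\<^sub>M borel"
        using measurable_cong_sets[OF refl sets_pi] by blast
      have "integrable (time_average T t) (\<lambda>s. g (M s \<omega>))"
        using K by (intro U.integrable_bounded[of _ K]) auto
      then show eq: "D g t \<omega> = (\<integral>s. g0 (M s \<omega>) \<partial>time_average T t)"
        by (simp add: D_def g0_def U.prob_space)
      have "\<bar>D g t \<omega>\<bar> \<le> (\<integral>s. \<bar>g0 (M s \<omega>)\<bar> \<partial>time_average T t)"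
        unfolding eq by (rule integral_abs_bound)
      also have "\<dots> \<le> (\<integral>s. K0 \<partial>time_average T t)"
        using g0K K0 by (intro integral_mono integrable_abs U.integrable_bounded[of _ K0]) auto
      finally show "\<bar>D g t \<omega>\<bar> \<le> K0" by (simp add: U.prob_space)
      have [measurable]: "g \<in> borel_measurable \<pi>"
        using bounded_lipschitz_measurable[OF g] by (simp add: measurable_pi_iff)
      show "D g t \<in> borel_measurable P\<pi>" unfolding D_def by measurable
    qed
    have "\<forall>\<^sub>F t in time_at_top T. (\<integral>\<omega>. (\<integral>s. g0 (M s \<omega>) \<partial>time_average T t)\<^sup>2 \<partial>P\<pi>) = (\<integral>\<omega>. (D g t \<omega>)\<^sup>2 \<partial>P\<pi>)"
      using eventually_time_at_top[of T 0]
      by eventually_elim (auto intro!: Bochner_Integration.integral_cong simp: D_eq)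
    from Lim_transform_eventually[OF second_moment_average_tendsto[OF g0m g0K lim0] this]
    show ?thesis
    proof (rule tendsto_moment_of_second_moment[OF P\<pi>.prob_space_axioms p, rotated])
      \<comment> \<open>\<open>D_meas\<close> was proved together with pointwise facts and carries
        their premise; any sample point discharges it.\<close>
      obtain \<omega>0 where "\<omega>0 \<in> space P\<pi>" using P\<pi>.not_empty by auto
      then show "\<forall>\<^sub>F t in time_at_top T. D g t \<in> borel_measurable P\<pi> \<and> (\<forall>\<omega>\<in>space P\<pi>. \<bar>D g t \<omega>\<bar> \<le> K0)"
        using D_le D_meas by (intro eventually_mono[OF eventually_time_at_top[of T 0]]) blast
    qed
  qed
  have "((\<lambda>t. \<integral>\<omega>. \<bar>D f t \<omega>\<bar> powr p \<partial>P\<pi>) \<longlongrightarrow> 0) (time_at_top T)"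
  proof (rule tendstoI)
    fix e :: real assume "0 < e"
    define c :: real where "c = 2 powr p"
    have c: "0 < c" by (simp add: c_def)
    \<comment> \<open>Two applications of \<open>abs_add_powr_le\<close> weight the average and the
      mean of \<open>h\<close> by \<open>c * c\<close> each, and the deviation of \<open>g\<close>
      by \<open>c\<close>. These errors sum to \<open>e / 4 + e / 4 + e / 2\<close>.\<close>
    have "0 < e / (4 * c * c)" using \<open>0 < e\<close> c by simp
    from Lp_bounded_lipschitz_approx[OF sets_pi \<pi>.finite_measure_axioms p f this]
    obtain g where g: "bounded_lipschitz g" and fg: "(\<integral>x. \<bar>f x - g x\<bar> powr p \<partial>\<pi>) < e / (4 * c * c)" .
    define h where "h x = f x - g x" for x
    have gL: "g \<in> Lp p \<pi>" by (rule bounded_lipschitz_Lp[OF sets_pi \<pi>.finite_measure_axioms g]) (use p in simp)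
    have hL: "h \<in> Lp p \<pi>" unfolding h_def using p by (intro Lp_diff f gL) auto
    note int = \<pi>.Lp_imp_integrable[OF p gL] \<pi>.Lp_imp_integrable[OF p hL]
    have "\<forall>\<^sub>F t in time_at_top T. (\<integral>\<omega>. \<bar>D g t \<omega>\<bar> powr p \<partial>P\<pi>) < e / (2 * c)"
      using \<open>0 < e\<close> c by (intro order_tendstoD(2)[OF D_lip[OF g]]) auto
    then show "\<forall>\<^sub>F t in time_at_top T. dist (\<integral>\<omega>. \<bar>D f t \<omega>\<bar> powr p \<partial>P\<pi>) 0 < e"
      using eventually_time_at_top[of T 0]
    proof eventually_elim
      case (elim t)
      then have t: "t \<in> T" "0 < t" by auto
      interpret stationary_average "time_average T t" P\<pi> \<pi> M by (rule stationary_average[OF t])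
      define X where "X u \<omega> = (\<integral>s. u (M s \<omega>) \<partial>time_average T t)" for u :: "'a \<Rightarrow> real" and \<omega>
      note XL = average_Lp[OF p, folded X_def]
      have hi: "integrable P\<pi> (\<lambda>\<omega>. \<bar>X h \<omega>\<bar> powr p)" using XL(1)[OF hL] by (simp add: Lp_def)
      have gi: "integrable P\<pi> (\<lambda>\<omega>. \<bar>D g t \<omega>\<bar> powr p)"
        using Lp_diff[OF _ XL(1)[OF gL] P\<pi>.Lp_const, of "\<integral>x. g x \<partial>\<pi>"] p by (simp add: Lp_def D_def X_def)
      have h\<pi>: "\<bar>\<integral>x. h x \<partial>\<pi>\<bar> powr p \<le> (\<integral>x. \<bar>h x\<bar> powr p \<partial>\<pi>)"
        using hL by (intro \<pi>.abs_expectation_powr_le[OF p]) (auto simp: Lp_def)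
      have "(\<integral>\<omega>. \<bar>D f t \<omega>\<bar> powr p \<partial>P\<pi>) \<le>
          (\<integral>\<omega>. c * (c * (\<bar>X h \<omega>\<bar> powr p + \<bar>\<integral>x. h x \<partial>\<pi>\<bar> powr p) + \<bar>D g t \<omega>\<bar> powr p) \<partial>P\<pi>)"
      proof (rule integral_mono_AE')
        show "integrable P\<pi> (\<lambda>\<omega>. c * (c * (\<bar>X h \<omega>\<bar> powr p + \<bar>\<integral>x. h x \<partial>\<pi>\<bar> powr p) + \<bar>D g t \<omega>\<bar> powr p))"
          using hi gi by simp
        show "AE \<omega> in P\<pi>. \<bar>D f t \<omega>\<bar> powr p \<le>
            c * (c * (\<bar>X h \<omega>\<bar> powr p + \<bar>\<integral>x. h x \<partial>\<pi>\<bar> powr p) + \<bar>D g t \<omega>\<bar> powr p)"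
          \<comment> \<open>Splitting the average of \<open>f\<close> along a path needs
            \<open>g\<close> and \<open>h\<close> integrable along it, so the decomposition holds
            only almost everywhere.\<close>
          using AE_integrable_average[OF int(1)] AE_integrable_average[OF int(2)]
        proof eventually_elim
          case (elim \<omega>)
          have "X f \<omega> = (\<integral>s. h (M s \<omega>) + g (M s \<omega>) \<partial>time_average T t)"
            by (simp add: X_def h_def)
          also have "\<dots> = X h \<omega> + X g \<omega>" using elim by (simp add: X_def)
          moreover have "(\<integral>x. f x \<partial>\<pi>) = (\<integral>x. h x + g x \<partial>\<pi>)" by (simp add: h_def)
          ultimately have Df: "D f t \<omega> = (X h \<omega> + - (\<integral>x. h x \<partial>\<pi>)) + D g t \<omega>"
            using int by (simp add: D_def X_def)
          have "\<bar>D f t \<omega>\<bar> powr p \<le> c * (\<bar>X h \<omega> + - (\<integral>x. h x \<partial>\<pi>)\<bar> powr p + \<bar>D g t \<omega>\<bar> powr p)"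
            unfolding Df c_def using p by (intro abs_add_powr_le) simp
          also have "\<dots> \<le> c * (c * (\<bar>X h \<omega>\<bar> powr p + \<bar>\<integral>x. h x \<partial>\<pi>\<bar> powr p) + \<bar>D g t \<omega>\<bar> powr p)"
            using abs_add_powr_le[of p "X h \<omega>" "- (\<integral>x. h x \<partial>\<pi>)"] p c
            by (intro mult_left_mono add_right_mono) (auto simp: c_def)
          finally show ?case .
        qed
      qed (use c in simp)
      also have "\<dots> = c * (c * ((\<integral>\<omega>. \<bar>X h \<omega>\<bar> powr p \<partial>P\<pi>) + \<bar>\<integral>x. h x \<partial>\<pi>\<bar> powr p) + (\<integral>\<omega>. \<bar>D g t \<omega>\<bar> powr p \<partial>P\<pi>))"
        using hi gi by (simp add: P\<pi>.prob_space)
      also have "\<dots> < c * (c * (e / (4 * c * c) + e / (4 * c * c)) + e / (2 * c))"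
        using c elim XL(2)[OF hL] h\<pi> fg
        by (intro mult_strict_left_mono add_strict_mono) (auto simp: h_def[symmetric])
      also have "\<dots> = e" using c by (simp add: field_simps)
      finally show ?case by simp
    qed
  qed
  then show ?thesis by (simp add: D_def)
qed

end

section \<open>Convergence of time averages in the p-th mean\<close>

theorem corollary1p5:
  fixes T :: "real set"
    and F :: "'w measure"
    and P :: "'a :: polish_space \<Rightarrow> 'w measure"
    and Ft :: "real \<Rightarrow> 'w measure"
    and \<theta> :: "real \<Rightarrow> 'w \<Rightarrow> 'w"
    and M :: "real \<Rightarrow> 'w \<Rightarrow> 'a"
    and \<pi> :: "'a measure"
    and p :: real
    and f :: "'a \<Rightarrow> real"
  assumes dist_le_1: "\<And>x y :: 'a. dist x y \<le> 1"
    and markov: "markov_process T F P Ft \<theta> M"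
    and pi_prob: "prob_space \<pi>" "sets \<pi> = sets borel"
    and ergodic: "\<And>x. ((\<lambda>t. SUP s\<in>T. \<integral>y. wasserstein (transition P M t y) \<pi> \<partial>(transition P M s x))
                        \<longlongrightarrow> 0) (time_at_top T)"
    and invariant: "invariant_measure T P M \<pi>"
    and loc_compact: "locally_compact_space (euclidean :: 'a topology)"
    and p_ge_1: "p \<ge> 1"
    and f_Lp: "f \<in> Lp p \<pi>"
  shows "(\<forall>t\<in>T. AE \<omega> in \<pi> \<bind> P. set_integrable (time_measure T) {0..<t} (\<lambda>s. f (M s \<omega>))) \<and>
         tendsto_Lp p (\<pi> \<bind> P)
           (\<lambda>t \<omega>. 1 / t * (LINT s:{0..<t}|time_measure T. f (M s \<omega>)))
           (\<lambda>\<omega>. \<integral>y. f y \<partial>\<pi>)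
           (time_at_top T)"
proof -
  interpret markov_process T F P Ft \<theta> M by (rule markov)
  interpret \<pi>: prob_space \<pi> by (rule pi_prob)
  interpret stationary_markov_process T F P Ft \<theta> M \<pi>
    by unfold_locales (rule pi_prob invariant)+
  have fm: "f \<in> borel_measurable \<pi>" using f_Lp by (simp add: Lp_def)
  have fi: "integrable \<pi> f" by (rule \<pi>.Lp_imp_integrable[OF p_ge_1 f_Lp])
  let ?X = "\<lambda>t \<omega>. 1 / t * (LINT s:{0..<t}|time_measure T. f (M s \<omega>))"
  let ?c = "\<integral>y. f y \<partial>\<pi>"
  have path: "(\<lambda>s. f (M s \<omega>)) \<in> borel_measurable (time_measure T)" if "\<omega> \<in> space P\<pi>" for \<omega>
  proof -
    have "(\<lambda>s. M s \<omega>) \<in> time_measure T \<rightarrow>\<^sub>M borel"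
      using measurable_Pair1[OF M_jointly_measurable, of \<omega>] that by (simp add: space_P\<pi>)
    moreover have "f \<in> borel_measurable borel" using fm by (simp add: measurable_pi_iff)
    ultimately show ?thesis by (rule measurable_compose)
  qed
  have X_eq: "?X t \<omega> = (\<integral>s. f (M s \<omega>) \<partial>time_average T t)" if "t \<in> T" "0 < t" "\<omega> \<in> space P\<pi>" for t \<omega>
    using integral_time_average[OF time_set that(2) path[OF that(3)]] by simp
  have "AE \<omega> in P\<pi>. set_integrable (time_measure T) {0..<t} (\<lambda>s. f (M s \<omega>))" if t: "t \<in> T" for t
  \<comment> \<open>In \<open>T\<close> the other case is \<open>t = 0\<close>, where the interval
    of integration is empty.\<close>
  proof (cases "0 < t")
    case True
    interpret stationary_average "time_average T t" P\<pi> \<pi> M by (rule stationary_average[OF t True])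
    show ?thesis
      using AE_integrable_average[OF fi] AE_space
      by eventually_elim (simp add: integrable_time_average_iff[OF time_set True path])
  qed (simp add: set_integrable_def)
  moreover have "tendsto_Lp p P\<pi> ?X (\<lambda>\<omega>. ?c) (time_at_top T)"
    unfolding tendsto_Lp_def
  proof (intro conjI)
    show "\<forall>\<^sub>F t in time_at_top T. ?X t \<in> Lp p P\<pi>"
      using eventually_time_at_top[of T 0]
    proof eventually_elim
      case (elim t)
      then have t: "t \<in> T" "0 < t" by auto
      interpret stationary_average "time_average T t" P\<pi> \<pi> M by (rule stationary_average[OF t])
      from average_Lp(1)[OF p_ge_1 f_Lp] show ?case
        by (rule Lp_cong[THEN iffD1, rotated]) (rule X_eq[OF t, symmetric])
    qed
    show "(\<lambda>\<omega>. ?c) \<in> Lp p P\<pi>" by (rule P\<pi>.Lp_const)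
    have "((\<lambda>t. \<integral>\<omega>. \<bar>(\<integral>s. f (M s \<omega>) \<partial>time_average T t) - ?c\<bar> powr p \<partial>P\<pi>) \<longlongrightarrow> 0) (time_at_top T)"
      by (rule moment_average_tendsto[OF p_ge_1 f_Lp integral_transition_tendsto[OF dist_le_1 ergodic]])
    moreover have "\<forall>\<^sub>F t in time_at_top T.
        (\<integral>\<omega>. \<bar>(\<integral>s. f (M s \<omega>) \<partial>time_average T t) - ?c\<bar> powr p \<partial>P\<pi>) = (\<integral>\<omega>. \<bar>?X t \<omega> - ?c\<bar> powr p \<partial>P\<pi>)"
      using eventually_time_at_top[of T 0]
      by eventually_elim (intro Bochner_Integration.integral_cong refl, simp only: X_eq)
    ultimately have "((\<lambda>t. \<integral>\<omega>. \<bar>?X t \<omega> - ?c\<bar> powr p \<partial>P\<pi>) \<longlongrightarrow> 0) (time_at_top T)"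
      by (rule Lim_transform_eventually)
    \<comment> \<open>The p-th root is continuous at 0, so convergence of the p-th moments is
      convergence of the norms.\<close>
    then show "((\<lambda>t. Lp_norm p P\<pi> (\<lambda>\<omega>. ?X t \<omega> - ?c)) \<longlongrightarrow> 0) (time_at_top T)"
      unfolding Lp_norm_def using p_ge_1 by (intro tendsto_zero_powrI[where b = "1 / p"]) auto
  qed
  ultimately show ?thesis unfolding P\<pi>_def by blast
qed

end
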